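(* Let $p$ be an odd prime. For each $i\geq 0$ and $n\geq 1$, let $$A_{i}=E(v_{i},2np^{i}+1)\otimes\Gamma(w_{i},2np^{i+1}+2)$$ be the tensor product of the $\mathbb{Z}_p$-exterior algebra on a generator $v_i$ of degree $2np^i+1$ and the $\mathbb{Z}_p$-divided power algebra on a generator $w_i$ of degree $2np^{i+1}+2$. Let $\mu=(\mu_{E}\otimes\mu_{\Gamma})\sigma_{2,2}$ be the induced multiplication on $A_i$. Writing $\gamma_j=\gamma_j(w_i)$, define linear maps $\Delta_2:A_i\to A_i^{\otimes 2}$ and $\Delta_p:A_i\to A_i^{\otimes p}$ for $e\in\{0,1\}$ and $j\geq 0$ by $$\Delta_{2}(v_i^{e}\gamma_{j})=\sum_{k=0}^{e}\sum_{l=0}^{j}v_i^{k}\gamma_{l}\otimes v_i^{e-k}\gamma_{j-l},$$ $$\Delta_{p}(v_i^{e}\gamma_{j})=\sum_{k_{1}+\cdots+k_{p}=j-1}v_i^{e+1}\gamma_{k_{1}}\otimes\cdots\otimes v_i^{e+1}\gamma_{k_{p}},$$ where the second sum is over $p$-tuples of non-negative integers (so it is $0$ if $j=0$) and $v_i^2=0$. Then $(A_{i},\Delta_{2},\Delta_{p},\mu)$ is a Hopf $A_{\infty}$-coalgebra over $\mathbb{Z}_{p}$.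
   Context: Here $\mathbb{Z}_p=\mathbb{Z}/p\mathbb{Z}$. All modules are graded, all tensor products are over the ground ring $R$ (here $R=\mathbb{Z}_p$), and the Koszul sign convention applies: $(f\otimes g)(a\otimes b)=(-1)^{|g||a|}f(a)\otimes g(b)$. $\mathrm{Hom}^{k}(A,B)$ denotes the linear maps raising degree by $k$. Exterior and divided power algebras. $E(v,d)$ ($d$ odd) is the exterior algebra with basis $\{1,v\}$, $|v|=d$, multiplication $\mu_E$ with $v\cdot v=0$, and $v$ primitive. $\Gamma(w,d)$ ($d$ even) has basis $\{\gamma_j=\gamma_j(w)\}_{j\ge 0}$ with $\gamma_0=1$, $\gamma_1=w$, $|\gamma_j|=jd$, multiplication $\mu_\Gamma(\gamma_i\otimes\gamma_j)=\binom{i+j}{i}\gamma_{i+j}$, and coproduct $\Delta(\gamma_k)=\sum_{i+j=k}\gamma_i\otimes\gamma_j$. In $E\otimes\Gamma$, write $v^e\gamma_j$ for $v^e\otimes\gamma_j$. Permutations. $\sigma_{m,2}:(A^{\otimes m})^{\otimes 2}\to (A^{\otimes 2})^{\otimes m}$ is the canonical permutation of tensor factors $(a_1\otimes\cdots\otimes a_m)\otimes(b_1\otimes\cdots\otimes b_m)\mapsto \pm (a_1\otimes b_1)\otimes\cdots\otimes(a_m\otimes b_m)$ with Koszul sign. In $\mu=(\mu_{E}\otimes\mu_{\Gamma})\sigma_{2,2}$, $\sigma_{2,2}$ is the analogous signed interchange $(E\otimes\Gamma)\otimes(E\otimes\Gamma)\to(E\otimes E)\otimes(\Gamma\otimes\Gamma)$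 of the two middle factors. $A^{\otimes m}$ is an algebra with multiplication $\mu^{\otimes m}\sigma_{m,2}$. $A_\infty$-coalgebra. An $A_\infty$-coalgebra is a graded $R$-module $A$ with multilinear operations $\{\psi^k\in \mathrm{Hom}^{k-2}(A,A^{\otimes k})\}_{k\ge 1}$ such that for each $m\geq 1$, $$\sum_{0\le j\le m-1,\ 0\le i\le m-j-1}(-1)^{j(m+i+1)}\,\psi^{j+1}_{i,m-i-j-1}\,\psi^{m-j}=0,$$ where $\psi^{r}_{s,t}=\mathbf{1}^{\otimes s}\otimes\psi^{r}\otimes\mathbf{1}^{\otimes t}$. When only some operations are listed (e.g. $(A,\Delta,\Delta_m)$ with $\psi^2=\Delta$, $\psi^m=\Delta_m$), all other $\psi^k$ (including $\psi^1$) are zero. $(f,g)$-derivation. Let $(A,\mu_A)$ and $(B,\mu_B)$ be graded algebras and $f,g:A\to B$ algebra maps. A map $h:A\to B$ of degree $k$ is an $(f,g)$-derivation of degree $k$ if $h\mu_A=\mu_B(f\otimes h+h\otimes g)$. Hopf $A_\infty$-coalgebra. Let $m\ge 3$. A Hopf $A_\infty$-coalgebra is an $R$-Hopf algebra $(A,\Delta,\mu)$ (graded, with Koszul signs) together with an operation $\Delta_m\in \mathrm{Hom}^{m-2}(A,A^{\otimes m})$ such that $(A,\Delta,\Delta_m)$ is an $A_\infty$-coalgebra and $\Delta_m$ is an $(f^m,f^m)$-derivation of degree $m-2$, where $f^m=(\Delta\otimes\mathbf{1}^{\otimes m-2})\cdots(\Delta\otimes\mathbf{1})\Delta:A\to A^{\otimes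 m}$; explicitly, $$\Delta_{m}\mu=\mu^{\otimes m}\sigma_{m,2}(f^{m}\otimes\Delta_{m}+\Delta_{m}\otimes f^{m}).$$ In the theorem, $m=p$ and $\Delta=\Delta_2$. *)

theory Defs
  imports "HOL-Library.Poly_Mapping" "Berlekamp_Zassenhaus.Finite_Field"
begin

section \<open>Graded modules and their tensor powers\<close>

text \<open>
  A graded \<open>R\<close>-module \<open>A\<close> is presented by a homogeneous basis: a type \<open>'b\<close> of basis elements
  together with a degree function \<open>dg :: 'b \<Rightarrow> int\<close>.  (Over a field every graded module
  is of this form.)  The tensor power \<open>A\<^sup>\<otimes>\<^sup>m\<close> is then the free module on the words of length \<open>m\<close>
  in the basis, the word \<open>[b\<^sub>1,\<dots>,b\<^sub>m]\<close> standing for \<open>b\<^sub>1 \<otimes> \<dots> \<otimes> b\<^sub>m\<close>.  All tensor powers sit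
  inside one module, the finitely supported functions \<open>'b list \<Rightarrow>\<^sub>0 'r\<close>; in particular
  \<open>A\<close> is \<open>A\<^sup>\<otimes>\<^sup>1\<close> and the ground ring \<open>R\<close> is \<open>A\<^sup>\<otimes>\<^sup>0\<close>.
\<close>

type_synonym ('b, 'r) tens = "'b list \<Rightarrow>\<^sub>0 'r"

definition scale :: "'r::comm_ring_1 \<Rightarrow> ('a \<Rightarrow>\<^sub>0 'r) \<Rightarrow> ('a \<Rightarrow>\<^sub>0 'r)" where
  "scale c x = Poly_Mapping.map ((*) c) x"

lemma lookup_scale [simp]: "Poly_Mapping.lookup (scale c x) b = c * Poly_Mapping.lookup x b"
  unfolding scale_def by transfer (simp add: when_def)

lemma module_scale: "Modules.module (scale :: 'r::comm_ring_1 \<Rightarrow> ('a \<Rightarrow>\<^sub>0 'r) \<Rightarrow> ('a \<Rightarrow>\<^sub>0 'r))"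
  by (unfold_locales; auto intro!: poly_mapping_eqI simp: lookup_add algebra_simps)

definition basis :: "'a \<Rightarrow> ('a \<Rightarrow>\<^sub>0 'r::comm_ring_1)" where
  "basis b = Poly_Mapping.single b 1"

text \<open>The linear map with prescribed values on the basis.\<close>

definition lin :: "('a \<Rightarrow> ('c \<Rightarrow>\<^sub>0 'r)) \<Rightarrow> ('a \<Rightarrow>\<^sub>0 'r::comm_ring_1) \<Rightarrow> ('c \<Rightarrow>\<^sub>0 'r)" where
  "lin f x = (\<Sum>b\<in>Poly_Mapping.keys x. scale (Poly_Mapping.lookup x b) (f b))"

definition wdeg :: "('b \<Rightarrow> int) \<Rightarrow> 'b list \<Rightarrow> int" where
  "wdeg dg w = sum_list (map dg w)"

definition tpow :: "nat \<Rightarrow> ('b, 'r::comm_ring_1) tens set" where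
  "tpow m = {x. \<forall>w\<in>Poly_Mapping.keys x. length w = m}"

definition tpow_deg :: "('b \<Rightarrow> int) \<Rightarrow> nat \<Rightarrow> int \<Rightarrow> ('b, 'r::comm_ring_1) tens set" where
  "tpow_deg dg m d = {x\<in>tpow m. \<forall>w\<in>Poly_Mapping.keys x. wdeg dg w = d}"

text \<open>
  \<open>Hom dg k m n\<close> is \<open>Hom\<^sup>k(A\<^sup>\<otimes>\<^sup>m, A\<^sup>\<otimes>\<^sup>n)\<close>.  Maps are represented by linear maps on
  the sum of all tensor powers, of which only the restriction to \<open>A\<^sup>\<otimes>\<^sup>m\<close> matters:
  every equation between such maps below is stated on that submodule only.
\<close>

definition Hom :: "('b \<Rightarrow> int) \<Rightarrow> int \<Rightarrow> nat \<Rightarrow> nat \<Rightarrow>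
    (('b, 'r::comm_ring_1) tens \<Rightarrow> ('b, 'r) tens) set" where
  "Hom dg k m n = {f. Modules.module_hom scale scale f \<and> f ` tpow m \<subseteq> tpow n \<and>
     (\<forall>d. f ` tpow_deg dg m d \<subseteq> tpow_deg dg n (d + k))}"

definition ksign :: "int \<Rightarrow> 'r::comm_ring_1" where
  "ksign k = (if even k then 1 else - 1)"

definition tensor :: "('b, 'r::comm_ring_1) tens \<Rightarrow> ('b, 'r) tens \<Rightarrow> ('b, 'r) tens" where
  "tensor x y = lin (\<lambda>u. lin (\<lambda>v. basis (u @ v)) y) x"

text \<open>
  \<open>tensor_map dg a f k g\<close> is \<open>f \<otimes> g\<close> with the Koszul sign, where \<open>f\<close> is defined on
  \<open>A\<^sup>\<otimes>\<^sup>a\<close> and \<open>g\<close> has degree \<open>k\<close>.  (The source of \<open>g\<close> is determined by the length of the word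
  to which \<open>f \<otimes> g\<close> is applied.)
\<close>

definition tensor_map :: "('b \<Rightarrow> int) \<Rightarrow> nat \<Rightarrow> (('b, 'r::comm_ring_1) tens \<Rightarrow> ('b, 'r) tens) \<Rightarrow>
    int \<Rightarrow> (('b, 'r) tens \<Rightarrow> ('b, 'r) tens) \<Rightarrow> ('b, 'r) tens \<Rightarrow> ('b, 'r) tens" where
  "tensor_map dg a f k g = lin (\<lambda>w. scale (ksign (k * wdeg dg (take a w)))
     (tensor (f (basis (take a w))) (g (basis (drop a w)))))"

text \<open>
  \<open>insert_map dg s a k f\<close> is \<open>1\<^sup>\<otimes>\<^sup>s \<otimes> f \<otimes> 1\<^sup>\<otimes>\<^sup>t\<close> for \<open>f\<close> of degree \<open>k\<close> defined on \<open>A\<^sup>\<otimes>\<^sup>a\<close>.  It does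
  not take \<open>t\<close> as an argument: \<open>t\<close> is whatever is left of the word.
\<close>

definition insert_map :: "('b \<Rightarrow> int) \<Rightarrow> nat \<Rightarrow> nat \<Rightarrow> int \<Rightarrow>
    (('b, 'r::comm_ring_1) tens \<Rightarrow> ('b, 'r) tens) \<Rightarrow> ('b, 'r) tens \<Rightarrow> ('b, 'r) tens" where
  "insert_map dg s a k f = tensor_map dg s id k (tensor_map dg a f 0 id)"

text \<open>The power \<open>f\<^sup>\<otimes>\<^sup>n\<close> of a map \<open>f\<close> of degree \<open>0\<close> defined on \<open>A\<^sup>\<otimes>\<^sup>a\<close>.\<close>

primrec map_power :: "('b \<Rightarrow> int) \<Rightarrow> nat \<Rightarrow> (('b, 'r::comm_ring_1) tens \<Rightarrow> ('b, 'r) tens) \<Rightarrow>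
    nat \<Rightarrow> ('b, 'r) tens \<Rightarrow> ('b, 'r) tens" where
  "map_power dg a f 0 = id"
| "map_power dg a f (Suc n) = tensor_map dg a f 0 (map_power dg a f n)"

text \<open>
  \<open>\<sigma>\<^sub>m\<^sub>,\<^sub>2\<close> sends \<open>a\<^sub>1\<dots>a\<^sub>m b\<^sub>1\<dots>b\<^sub>m\<close> to \<open>\<plusminus> a\<^sub>1 b\<^sub>1 \<dots> a\<^sub>m b\<^sub>m\<close>; the factor \<open>b\<^sub>i\<close> moves past every \<open>a\<^sub>j\<close>
  with \<open>j > i\<close>.
\<close>

definition sigma :: "('b \<Rightarrow> int) \<Rightarrow> nat \<Rightarrow> ('b, 'r::comm_ring_1) tens \<Rightarrow> ('b, 'r) tens" where
  "sigma dg m = lin (\<lambda>w. scale (ksign (\<Sum>j<m. \<Sum>i<j. dg (w ! (m + i)) * dg (w ! j)))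
     (basis (concat (map (\<lambda>(a, b). [a, b]) (zip (take m w) (drop m w))))))"

text \<open>The multiplication of the algebra \<open>A\<^sup>\<otimes>\<^sup>m\<close>, as a map \<open>A\<^sup>\<otimes>\<^sup>2\<^sup>m \<rightarrow> A\<^sup>\<otimes>\<^sup>m\<close>.\<close>

definition mult_tpow :: "('b \<Rightarrow> int) \<Rightarrow> nat \<Rightarrow> (('b, 'r::comm_ring_1) tens \<Rightarrow> ('b, 'r) tens) \<Rightarrow>
    ('b, 'r) tens \<Rightarrow> ('b, 'r) tens" where
  "mult_tpow dg m \<mu> = map_power dg 2 \<mu> m \<circ> sigma dg m"


section \<open>Hopf \<open>A\<^sub>\<infinity>\<close>-coalgebras\<close>

definition Ainf_coalgebra :: "('b \<Rightarrow> int) \<Rightarrow>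
    (nat \<Rightarrow> ('b, 'r::comm_ring_1) tens \<Rightarrow> ('b, 'r) tens) \<Rightarrow> bool" where
  "Ainf_coalgebra dg \<psi> \<longleftrightarrow>
     (\<forall>k\<ge>1. \<psi> k \<in> Hom dg (int k - 2) 1 k) \<and>
     (\<forall>m\<ge>1. \<forall>x\<in>tpow 1.
        (\<Sum>j\<in>{0..m - 1}. \<Sum>i\<in>{0..m - j - 1}.
           scale ((- 1) ^ (j * (m + i + 1)))
             (insert_map dg i 1 (int (j + 1) - 2) (\<psi> (j + 1)) (\<psi> (m - j) x))) = 0)"

text \<open>
  Graded Hopf algebras, with unit \<open>\<eta> : R \<rightarrow> A\<close>, counit \<open>\<epsilon> : A \<rightarrow> R\<close> and antipode \<open>S\<close>, which are
  determined by \<open>\<Delta>\<close> and \<open>\<mu>\<close>.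
\<close>

definition Hopf_algebra :: "('b \<Rightarrow> int) \<Rightarrow> (('b, 'r::comm_ring_1) tens \<Rightarrow> ('b, 'r) tens) \<Rightarrow>
    (('b, 'r) tens \<Rightarrow> ('b, 'r) tens) \<Rightarrow> bool" where
  "Hopf_algebra dg \<Delta> \<mu> \<longleftrightarrow>
     \<mu> \<in> Hom dg 0 2 1 \<and> \<Delta> \<in> Hom dg 0 1 2 \<and>
     (\<forall>x\<in>tpow 3. \<mu> (insert_map dg 0 2 0 \<mu> x) = \<mu> (insert_map dg 1 2 0 \<mu> x)) \<and>
     (\<forall>x\<in>tpow 1. insert_map dg 0 1 0 \<Delta> (\<Delta> x) = insert_map dg 1 1 0 \<Delta> (\<Delta> x)) \<and>
     (\<forall>x\<in>tpow 2. \<Delta> (\<mu> x) = mult_tpow dg 2 \<mu> (tensor_map dg 1 \<Delta> 0 \<Delta> x)) \<and>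
     (\<exists>\<eta> \<epsilon> S. \<eta> \<in> Hom dg 0 0 1 \<and> \<epsilon> \<in> Hom dg 0 1 0 \<and> S \<in> Hom dg 0 1 1 \<and>
        (\<forall>x\<in>tpow 1. \<mu> (tensor_map dg 0 \<eta> 0 id x) = x \<and> \<mu> (tensor_map dg 1 id 0 \<eta> x) = x) \<and>
        (\<forall>x\<in>tpow 1. tensor_map dg 1 \<epsilon> 0 id (\<Delta> x) = x \<and> tensor_map dg 1 id 0 \<epsilon> (\<Delta> x) = x) \<and>
        (\<forall>x\<in>tpow 0. \<Delta> (\<eta> x) = tensor_map dg 0 \<eta> 0 \<eta> x) \<and>
        (\<forall>x\<in>tpow 2. \<epsilon> (\<mu> x) = tensor_map dg 1 \<epsilon> 0 \<epsilon> x) \<and>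
        (\<forall>x\<in>tpow 0. \<epsilon> (\<eta> x) = x) \<and>
        (\<forall>x\<in>tpow 1. \<mu> (tensor_map dg 1 S 0 id (\<Delta> x)) = \<eta> (\<epsilon> x) \<and>
                    \<mu> (tensor_map dg 1 id 0 S (\<Delta> x)) = \<eta> (\<epsilon> x)))"

text \<open>
  Algebra maps and derivations from \<open>(A, \<mu>)\<close> to \<open>(A\<^sup>\<otimes>\<^sup>m, \<nu>)\<close>, where \<open>\<nu> : A\<^sup>\<otimes>\<^sup>m \<otimes> A\<^sup>\<otimes>\<^sup>m \<rightarrow> A\<^sup>\<otimes>\<^sup>m\<close>.
\<close>

definition algebra_map :: "('b \<Rightarrow> int) \<Rightarrow> nat \<Rightarrow> (('b, 'r::comm_ring_1) tens \<Rightarrow> ('b, 'r) tens) \<Rightarrow>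
    (('b, 'r) tens \<Rightarrow> ('b, 'r) tens) \<Rightarrow> (('b, 'r) tens \<Rightarrow> ('b, 'r) tens) \<Rightarrow> bool" where
  "algebra_map dg m \<mu> \<nu> f \<longleftrightarrow> f \<in> Hom dg 0 1 m \<and>
     (\<forall>x\<in>tpow 2. f (\<mu> x) = \<nu> (tensor_map dg 1 f 0 f x))"

definition is_derivation :: "('b \<Rightarrow> int) \<Rightarrow> nat \<Rightarrow> (('b, 'r::comm_ring_1) tens \<Rightarrow> ('b, 'r) tens) \<Rightarrow>
    (('b, 'r) tens \<Rightarrow> ('b, 'r) tens) \<Rightarrow> (('b, 'r) tens \<Rightarrow> ('b, 'r) tens) \<Rightarrow>
    (('b, 'r) tens \<Rightarrow> ('b, 'r) tens) \<Rightarrow> int \<Rightarrow> (('b, 'r) tens \<Rightarrow> ('b, 'r) tens) \<Rightarrow> bool" where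
  "is_derivation dg m \<mu> \<nu> f g k h \<longleftrightarrow>
     algebra_map dg m \<mu> \<nu> f \<and> algebra_map dg m \<mu> \<nu> g \<and> h \<in> Hom dg k 1 m \<and>
     (\<forall>x\<in>tpow 2. h (\<mu> x) = \<nu> (tensor_map dg 1 f k h x + tensor_map dg 1 h 0 g x))"

text \<open>
  \<open>iter_coprod dg \<Delta> n\<close> is \<open>f\<^sup>n\<^sup>+\<^sup>1 = (\<Delta> \<otimes> 1\<^sup>\<otimes>\<^sup>n\<^sup>-\<^sup>1) \<dots> (\<Delta> \<otimes> 1) \<Delta> : A \<rightarrow> A\<^sup>\<otimes>\<^sup>(\<^sup>n\<^sup>+\<^sup>1\<^sup>)\<close>.
\<close>

primrec iter_coprod :: "('b \<Rightarrow> int) \<Rightarrow> (('b, 'r::comm_ring_1) tens \<Rightarrow> ('b, 'r) tens) \<Rightarrow>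
    nat \<Rightarrow> ('b, 'r) tens \<Rightarrow> ('b, 'r) tens" where
  "iter_coprod dg \<Delta> 0 = id"
| "iter_coprod dg \<Delta> (Suc n) = tensor_map dg 1 \<Delta> 0 id \<circ> iter_coprod dg \<Delta> n"

definition Hopf_Ainf_coalgebra :: "('b \<Rightarrow> int) \<Rightarrow> nat \<Rightarrow>
    (('b, 'r::comm_ring_1) tens \<Rightarrow> ('b, 'r) tens) \<Rightarrow> (('b, 'r) tens \<Rightarrow> ('b, 'r) tens) \<Rightarrow>
    (('b, 'r) tens \<Rightarrow> ('b, 'r) tens) \<Rightarrow> bool" where
  "Hopf_Ainf_coalgebra dg m \<Delta> \<Delta>m \<mu> \<longleftrightarrow>
     m \<ge> 3 \<and>
     Hopf_algebra dg \<Delta> \<mu> \<and>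
     \<Delta>m \<in> Hom dg (int m - 2) 1 m \<and>
     Ainf_coalgebra dg (\<lambda>k. if k = 2 then \<Delta> else if k = m then \<Delta>m else (\<lambda>_. 0)) \<and>
     is_derivation dg m \<mu> (mult_tpow dg m \<mu>)
       (iter_coprod dg \<Delta> (m - 1)) (iter_coprod dg \<Delta> (m - 1)) (int m - 2) \<Delta>m"


section \<open>The algebras \<open>E(v,d)\<close>, \<open>\<Gamma>(w,d)\<close> and their tensor product\<close>

text \<open>
  The basis \<open>{1, v}\<close> of \<open>E(v,d)\<close> is the type \<open>bool\<close>, with \<open>True\<close> for \<open>v\<close>; the basis
  \<open>{\<gamma>\<^sub>j}\<close> of \<open>\<Gamma>(w,d)\<close> is the type \<open>nat\<close>.
\<close>

definition E_deg :: "int \<Rightarrow> bool \<Rightarrow> int" where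
  "E_deg d e = (if e then d else 0)"

definition E_mult :: "(bool, 'r::comm_ring_1) tens \<Rightarrow> (bool, 'r) tens" where
  "E_mult = lin (\<lambda>w. case w of [e, e'] \<Rightarrow> if e \<and> e' then 0 else basis [e \<or> e'] | _ \<Rightarrow> 0)"

definition Gamma_deg :: "int \<Rightarrow> nat \<Rightarrow> int" where
  "Gamma_deg d j = int j * d"

definition Gamma_mult :: "(nat, 'r::comm_ring_1) tens \<Rightarrow> (nat, 'r) tens" where
  "Gamma_mult = lin (\<lambda>w. case w of
     [i, j] \<Rightarrow> scale (of_nat ((i + j) choose i)) (basis [i + j]) | _ \<Rightarrow> 0)"

text \<open>
  The tensor product of modules with bases \<open>'a\<close> and \<open>'c\<close> has basis \<open>'a \<times> 'c\<close>, with \<open>(a, c)\<close>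
  standing for \<open>a \<otimes> c\<close>; \<open>tensor2\<close> is the element \<open>x \<otimes> y\<close>.
\<close>

definition prod_deg :: "('a \<Rightarrow> int) \<Rightarrow> ('c \<Rightarrow> int) \<Rightarrow> 'a \<times> 'c \<Rightarrow> int" where
  "prod_deg deg1 deg2 = (\<lambda>(a, c). deg1 a + deg2 c)"

definition tensor2 :: "('a, 'r::comm_ring_1) tens \<Rightarrow> ('c, 'r) tens \<Rightarrow> ('a \<times> 'c, 'r) tens" where
  "tensor2 x y = lin (\<lambda>u. lin (\<lambda>v. basis (zip u v)) y) x"

text \<open>
  \<open>(\<mu>\<^sub>1 \<otimes> \<mu>\<^sub>2) \<sigma>\<^sub>2\<^sub>,\<^sub>2\<close>, where \<open>\<sigma>\<^sub>2\<^sub>,\<^sub>2\<close> interchanges the two middle factors of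
  \<open>(a \<otimes> c) \<otimes> (a' \<otimes> c')\<close>.
\<close>

definition prod_mult :: "('a \<Rightarrow> int) \<Rightarrow> ('c \<Rightarrow> int) \<Rightarrow>
    (('a, 'r::comm_ring_1) tens \<Rightarrow> ('a, 'r) tens) \<Rightarrow> (('c, 'r) tens \<Rightarrow> ('c, 'r) tens) \<Rightarrow>
    ('a \<times> 'c, 'r) tens \<Rightarrow> ('a \<times> 'c, 'r) tens" where
  "prod_mult deg1 deg2 \<mu>1 \<mu>2 = lin (\<lambda>w. case w of
     [(a, c), (a', c')] \<Rightarrow> scale (ksign (deg2 c * deg1 a'))
        (tensor2 (\<mu>1 (basis [a, a'])) (\<mu>2 (basis [c, c'])))
     | _ \<Rightarrow> 0)"

definition A_deg :: "nat \<Rightarrow> nat \<Rightarrow> nat \<Rightarrow> bool \<times> nat \<Rightarrow> int" where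
  "A_deg p n i = prod_deg (E_deg (int (2 * n * p ^ i + 1))) (Gamma_deg (int (2 * n * p ^ (i + 1) + 2)))"

definition A_mult :: "nat \<Rightarrow> nat \<Rightarrow> nat \<Rightarrow>
    (bool \<times> nat, 'r::comm_ring_1) tens \<Rightarrow> (bool \<times> nat, 'r) tens" where
  "A_mult p n i =
     prod_mult (E_deg (int (2 * n * p ^ i + 1))) (Gamma_deg (int (2 * n * p ^ (i + 1) + 2)))
       E_mult Gamma_mult"

text \<open>The element \<open>v\<^sup>e \<gamma>\<^sub>j\<close> of \<open>E \<otimes> \<Gamma>\<close> for any exponent \<open>e\<close>, with \<open>v\<^sup>e = 0\<close> for \<open>e \<ge> 2\<close>.\<close>

definition vgam :: "nat \<Rightarrow> nat \<Rightarrow> (bool \<times> nat, 'r::comm_ring_1) tens" where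
  "vgam e j = (if e \<le> 1 then basis [(e = 1, j)] else 0)"

definition Delta_two :: "(bool \<times> nat, 'r::comm_ring_1) tens \<Rightarrow> (bool \<times> nat, 'r) tens" where
  "Delta_two = lin (\<lambda>w. case w of
     [(b, j)] \<Rightarrow> (let e = of_bool b in
        \<Sum>k\<in>{0..e}. \<Sum>l\<in>{0..j}. tensor (vgam k l) (vgam (e - k) (j - l)))
     | _ \<Rightarrow> 0)"

definition Delta_p :: "nat \<Rightarrow> (bool \<times> nat, 'r::comm_ring_1) tens \<Rightarrow> (bool \<times> nat, 'r) tens" where
  "Delta_p p = lin (\<lambda>w. case w of
     [(b, j)] \<Rightarrow> (let e = of_bool b in
        \<Sum>ks\<in>{ks. length ks = p \<and> sum_list ks + 1 = j}.
          foldr tensor (map (vgam (e + 1)) ks) (basis []))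
     | _ \<Rightarrow> 0)"

end

theory Submission
  imports Defs
begin

text \<open>
  For a word \<open>e\<^sub>1\<dots>e\<^sub>m\<close> of exponents let \<open>T(e\<^sub>1\<dots>e\<^sub>m; j)\<close> be the sum of all
  \<open>v\<^bsup>e\<^sub>1\<^esup>\<gamma>\<^bsub>k\<^sub>1\<^esub> \<otimes> \<dots> \<otimes> v\<^bsup>e\<^sub>m\<^esup>\<gamma>\<^bsub>k\<^sub>m\<^esub>\<close> with \<open>k\<^sub>1 + \<dots> + k\<^sub>m = j\<close>.  Every map in the theorem is a
  combination of such sums: \<open>f\<^sup>m(v\<^sup>e\<gamma>\<^sub>j)\<close> is the sum of \<open>T(w; j)\<close> over the words \<open>w\<close> with \<open>e\<close> letters
  equal to \<open>1\<close>, and \<open>\<Delta>\<^sub>p(\<gamma>\<^sub>j) = T(1\<dots>1; j - 1)\<close>.  By Vandermonde's convolution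
  \<open>T(w; a) T(w'; b) = \<plusminus> (a + b choose a) T(w + w'; a + b)\<close>, and \<open>0\<close> if \<open>w\<close> and \<open>w'\<close> overlap.  Thus the
  derivation property on \<open>\<gamma>\<^sub>a \<otimes> \<gamma>\<^sub>b\<close> is Pascal's rule
  \<open>(a + b choose a) = (a + b - 1 choose a) + (a + b - 1 choose a - 1)\<close>, and in all other cases both
  sides vanish because every factor already contains \<open>v\<close>.  Applying \<open>\<Delta>\<close> to the \<open>i\<close>-th factor of \<open>T(1\<dots>1; j)\<close>
  produces the two words with a \<open>0\<close> in position \<open>i\<close> or \<open>i + 1\<close>, so the relation between
  \<open>\<Delta>\<close> and \<open>\<Delta>\<^sub>p\<close> telescopes; the two remaining boundary words cancel against
  \<open>(\<Delta>\<^sub>p \<otimes> 1 + 1 \<otimes> \<Delta>\<^sub>p)\<Delta>\<close>.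
\<close>

section \<open>Linear maps on tensor powers\<close>

interpretation scale: Modules.module "scale :: 'r::comm_ring_1 \<Rightarrow> ('a \<Rightarrow>\<^sub>0 'r) \<Rightarrow> ('a \<Rightarrow>\<^sub>0 'r)"
  by (rule module_scale)

abbreviation linear_map :: "(('a \<Rightarrow>\<^sub>0 'r::comm_ring_1) \<Rightarrow> ('c \<Rightarrow>\<^sub>0 'r)) \<Rightarrow> bool" where
  "linear_map \<equiv> Modules.module_hom scale scale"

lemma linear_mapI:
  assumes "\<And>x y. f (x + y) = f x + f y" "\<And>c x. f (scale c x) = scale c (f x)"
  shows "linear_map f"
  using assms by (simp add: module_hom_iff scale.module_axioms)

lemma linear_map_id [simp]: "linear_map id" "linear_map (\<lambda>x. x)"
  by (rule linear_mapI; simp)+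

lemma linear_map_zero [simp]: "linear_map (\<lambda>_. 0)"
  by (rule linear_mapI; simp)

lemma linear_map_comp: "linear_map f \<Longrightarrow> linear_map g \<Longrightarrow> linear_map (\<lambda>x. f (g x))"
  by (simp add: module_hom_iff)

lemma linear_map_add: "linear_map f \<Longrightarrow> linear_map g \<Longrightarrow> linear_map (\<lambda>x. f x + g x)"
  by (auto intro!: linear_mapI simp: module_hom_iff scale.scale_right_distrib algebra_simps)

lemma linear_map_scale: "linear_map f \<Longrightarrow> linear_map (\<lambda>x. scale c (f x))"
  by (auto intro!: linear_mapI simp: module_hom_iff scale.scale_right_distrib mult.commute)

lemma linear_map_sum: "(\<And>i. i \<in> I \<Longrightarrow> linear_map (f i)) \<Longrightarrow> linear_map (\<lambda>x. \<Sum>i\<in>I. f i x)"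
  by (induction I rule: infinite_finite_induct) (auto intro: linear_map_add)

text \<open>Expansions of \<open>x\<close>, \<open>y\<close> and \<open>x + y\<close> have different
  sets of keys; a common finite index set makes them comparable term by term.\<close>

lemma lin_superset:
  assumes "finite K" "Poly_Mapping.keys x \<subseteq> K"
  shows "lin f x = (\<Sum>b\<in>K. scale (Poly_Mapping.lookup x b) (f b))"
  unfolding lin_def using assms by (intro sum.mono_neutral_left) (auto simp: in_keys_iff)

lemma linear_map_lin [simp]:
  fixes f :: "'a \<Rightarrow> ('c \<Rightarrow>\<^sub>0 'r::comm_ring_1)"
  shows "linear_map (lin f)"
proof (rule linear_mapI)
  fix x y :: "'a \<Rightarrow>\<^sub>0 'r" and c :: 'r
  let ?K = "Poly_Mapping.keys x \<union> Poly_Mapping.keys y"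
  have "Poly_Mapping.keys (x + y) \<subseteq> ?K"
    by (rule Poly_Mapping.keys_add)
  then show "lin f (x + y) = lin f x + lin f y"
    by (simp add: lin_superset[of ?K] lookup_add scale.scale_left_distrib sum.distrib)
  have "Poly_Mapping.keys (scale c x) \<subseteq> Poly_Mapping.keys x"
    by (auto simp: in_keys_iff)
  then show "lin f (scale c x) = scale c (lin f x)"
    by (simp add: lin_superset[of "Poly_Mapping.keys x"] scale.scale_sum_right)
qed

lemma lin_basis [simp]: "lin f (basis b) = f b"
  by (cases "(1::'b) = 0") (auto simp: lin_def basis_def poly_mapping_eq_iff fun_eq_iff)

lemma lin_0 [simp]: "lin f 0 = 0"
  by (simp add: lin_def)

lemma linear_map_expand:
  assumes "linear_map f"
  shows "f x = (\<Sum>b\<in>Poly_Mapping.keys x. scale (Poly_Mapping.lookup x b) (f (basis b)))"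
proof -
  have *: "x = (\<Sum>b\<in>Poly_Mapping.keys x. scale (Poly_Mapping.lookup x b) (basis b))"
    by (rule poly_mapping_eqI)
       (auto simp: lookup_sum basis_def lookup_single when_def in_keys_iff if_distrib cong: if_cong)
  show ?thesis
    by (subst *, subst module_hom.sum[OF assms]) (simp add: module_hom.scale[OF assms])
qed

text \<open>The axioms quantify over a fixed tensor power, so by linearity each of them is a check
  on words of that length.\<close>

lemma linear_map_eq_on_tpow:
  assumes "linear_map f" "linear_map g" "x \<in> tpow m"
    and "\<And>w. length w = m \<Longrightarrow> f (basis w) = g (basis w)"
  shows "f x = g x"
  unfolding linear_map_expand[OF assms(1), of x] linear_map_expand[OF assms(2), of x]
  using assms(3,4) by (intro sum.cong) (auto simp: tpow_def)

lemma lin_cong_on_basis: "linear_map f \<Longrightarrow> lin (\<lambda>w. f (basis w)) x = f x"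
  by (simp add: linear_map_expand[of f x] lin_def)

text \<open>Serves linearity of \<open>tensor\<close> in its second argument, which occurs inside
  the coefficients of the outer \<open>lin\<close>.\<close>

lemma linear_map_lin_param:
  assumes "\<And>u. linear_map (\<lambda>y. f y u)"
  shows "linear_map (\<lambda>y. lin (f y) x)"
  unfolding lin_def by (intro linear_map_sum linear_map_scale assms)

lemma linear_map_tensor_left [simp]: "linear_map (\<lambda>x. tensor x y)"
  unfolding tensor_def by simp

lemma linear_map_tensor_right [simp]: "linear_map (tensor x)"
  unfolding tensor_def by (rule linear_map_lin_param) simp

lemmas tensor_scale_left [simp] = module_hom.scale[OF linear_map_tensor_left]
  and tensor_scale_right [simp] = module_hom.scale[OF linear_map_tensor_right]
  and tensor_sum_left = module_hom.sum[OF linear_map_tensor_left]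
  and tensor_sum_right = module_hom.sum[OF linear_map_tensor_right]
  and tensor_0_left [simp] = module_hom.zero[OF linear_map_tensor_left]
  and tensor_0_right [simp] = module_hom.zero[OF linear_map_tensor_right]

lemma tensor_basis [simp]: "tensor (basis u) (basis v) = basis (u @ v)"
  by (simp add: tensor_def)

lemma linear_map_eqI:
  assumes "linear_map f" "linear_map g" "\<And>w. f (basis w) = g (basis w)"
  shows "f x = g x"
  unfolding linear_map_expand[OF assms(1), of x] linear_map_expand[OF assms(2), of x]
  by (simp add: assms(3))

lemma tensor_Nil_left [simp]: "tensor (basis []) x = x"
  by (rule linear_map_eqI[of "tensor (basis [])" "\<lambda>x. x"]) auto

lemma tensor_Nil_right [simp]: "tensor x (basis []) = x"
  by (rule linear_map_eqI[of "\<lambda>x. tensor x (basis [])" "\<lambda>x. x"]) auto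

section \<open>Homogeneous elements and the degree of a map\<close>

lemma tpow_degD: "x \<in> tpow_deg dg m d \<Longrightarrow> x \<in> tpow m"
  by (simp add: tpow_deg_def)

lemma tpow_add: "x \<in> tpow m \<Longrightarrow> y \<in> tpow m \<Longrightarrow> x + y \<in> tpow m"
  unfolding tpow_def using Poly_Mapping.keys_add[of x y] by blast

lemma tpow_scale: "x \<in> tpow m \<Longrightarrow> scale c x \<in> tpow m"
  by (auto simp: tpow_def in_keys_iff)

lemma tpow_sum: "(\<And>i. i \<in> I \<Longrightarrow> f i \<in> tpow m) \<Longrightarrow> (\<Sum>i\<in>I. f i) \<in> tpow m"
proof (induction I rule: infinite_finite_induct)
  case (insert i I)
  then show ?case by (simp add: tpow_add)
qed (simp_all add: tpow_def)

lemma tpow_deg_0 [simp]: "0 \<in> tpow_deg dg m d"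
  by (simp add: tpow_deg_def tpow_def)

lemma tpow_deg_add: "x \<in> tpow_deg dg m d \<Longrightarrow> y \<in> tpow_deg dg m d \<Longrightarrow> x + y \<in> tpow_deg dg m d"
  unfolding tpow_deg_def tpow_def using Poly_Mapping.keys_add[of x y] by blast

lemma tpow_deg_scale: "x \<in> tpow_deg dg m d \<Longrightarrow> scale c x \<in> tpow_deg dg m d"
  by (auto simp: tpow_deg_def tpow_def in_keys_iff)

lemma tpow_deg_sum: "(\<And>i. i \<in> I \<Longrightarrow> f i \<in> tpow_deg dg m d) \<Longrightarrow> (\<Sum>i\<in>I. f i) \<in> tpow_deg dg m d"
  by (induction I rule: infinite_finite_induct) (auto intro: tpow_deg_add)

lemma keys_basis: "Poly_Mapping.keys (basis w :: 'a \<Rightarrow>\<^sub>0 'r::comm_ring_1) \<subseteq> {w}"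
  by (auto simp: basis_def)

lemma basis_in_tpow_deg: "length w = m \<Longrightarrow> wdeg dg w = d \<Longrightarrow> basis w \<in> tpow_deg dg m d"
  using keys_basis[of w] by (auto simp: tpow_deg_def tpow_def)

text \<open>Words are homogeneous, so the values on words decide both the number of tensor factors
  and the shift of degree.\<close>

lemma HomI:
  fixes f :: "('b, 'r::comm_ring_1) tens \<Rightarrow> ('b, 'r) tens"
  assumes f: "linear_map f"
    and deg: "\<And>w. length w = m \<Longrightarrow> f (basis w) \<in> tpow_deg dg n (wdeg dg w + k)"
  shows "f \<in> Hom dg k m n"
proof -
  have "f x \<in> tpow n" if "x \<in> tpow m" for x
    unfolding linear_map_expand[OF f, of x]
  proof (intro tpow_sum tpow_scale)
    fix b assume "b \<in> Poly_Mapping.keys x"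
    then have "length b = m"
      using that by (auto simp: tpow_def)
    then show "f (basis b) \<in> tpow n"
      by (rule tpow_degD[OF deg])
  qed
  moreover have "f x \<in> tpow_deg dg n (d + k)" if "x \<in> tpow_deg dg m d" for x d
    unfolding linear_map_expand[OF f, of x]
  proof (intro tpow_deg_sum tpow_deg_scale)
    fix b assume "b \<in> Poly_Mapping.keys x"
    then have "length b = m" "wdeg dg b = d"
      using that by (auto simp: tpow_deg_def tpow_def)
    then show "f (basis b) \<in> tpow_deg dg n (d + k)"
      using deg[of b] by simp
  qed
  ultimately show ?thesis
    using f by (auto simp: Hom_def)
qed

section \<open>Linearity of the tensor operations and their values on words\<close>

lemma linear_map_tensor_map [simp]: "linear_map (tensor_map dg a f k g)"
  by (simp add: tensor_map_def)

lemma linear_map_insert_map [simp]: "linear_map (insert_map dg s a k f)"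
  by (simp add: insert_map_def)

lemma linear_map_map_power: "linear_map (map_power dg a f n)"
  by (cases n) simp_all

lemma linear_map_mult_tpow [simp]: "linear_map (mult_tpow dg m f)"
  unfolding mult_tpow_def comp_def
  by (rule linear_map_comp[OF linear_map_map_power]) (simp add: sigma_def)

lemma linear_map_iter_coprod [simp]: "linear_map (iter_coprod dg f n)"
proof (induction n)
  case (Suc n)
  then show ?case
    unfolding iter_coprod.simps comp_def by (rule linear_map_comp[OF linear_map_tensor_map])
qed simp

lemma ksign_even [simp]: "even k \<Longrightarrow> ksign k = 1"
  by (simp add: ksign_def)

lemma ksign_add: "ksign (a + b) = ksign a * ksign b"
  by (simp add: ksign_def)

lemma tensor_map_basis:
  "length u = a \<Longrightarrow> tensor_map dg a f k g (basis (u @ v)) =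
     scale (ksign (k * wdeg dg u)) (tensor (f (basis u)) (g (basis v)))"
  by (simp add: tensor_map_def)

text \<open>Only the prefix \<open>u\<close> contributes a sign: \<open>f\<close> moves past it,
  while the identity to the right of \<open>f\<close> has degree 0.\<close>

lemma insert_map_basis:
  assumes "length u = s" "length v = a"
  shows "insert_map dg s a k f (basis (u @ v @ w)) =
    scale (ksign (k * wdeg dg u)) (tensor (basis u) (tensor (f (basis v)) (basis w)))"
  by (simp add: insert_map_def tensor_map_basis assms)

lemma insert_map_zero [simp]: "insert_map dg s a k (\<lambda>_. 0) x = 0"
proof -
  have "linear_map (insert_map dg s a k (\<lambda>_. 0))" by simp
  then show ?thesis
    by (rule linear_map_eqI[of _ "\<lambda>_. 0"]) (simp_all add: insert_map_def tensor_map_def)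
qed

section \<open>The multiplication of a tensor power on words\<close>

lemma mult_tpow_Nil [simp]: "mult_tpow dg 0 \<mu> (basis []) = basis []"
  by (simp add: mult_tpow_def sigma_def)

text \<open>To reach \<open>a\<close>, the letter \<open>b\<close> crosses all of \<open>u\<close>,
  which gives the sign; the remaining crossings are those of \<open>sigma dg m\<close> on
  \<open>u @ v\<close>.\<close>

lemma mult_tpow_Cons:
  fixes \<mu> :: "('b, 'r::comm_ring_1) tens \<Rightarrow> ('b, 'r) tens"
  assumes "length u = m" "length v = m"
  shows "mult_tpow dg (Suc m) \<mu> (basis ((a # u) @ (b # v))) =
    scale (ksign (dg b * wdeg dg u)) (tensor (\<mu> (basis [a, b])) (mult_tpow dg m \<mu> (basis (u @ v))))"
proof -
  let ?c = "concat (map (\<lambda>(a, b). [a, b]) (zip u v))"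
  let ?s = "\<Sum>j<m. \<Sum>i<j. dg (v ! i) * dg (u ! j)"
  have wd: "wdeg dg u = (\<Sum>j<m. dg (u ! j))"
    using assms(1) by (simp add: wdeg_def sum_list_sum_nth atLeast0LessThan)
  \<comment> \<open>The outer index 0 has an empty inner sum and disappears. In the shifted sum the
    terms with \<open>i = 0\<close> are the crossings of \<open>b\<close> with
    \<open>u\<close>.\<close>
  have "(\<Sum>j<Suc m. \<Sum>i<j. dg (((a # u) @ (b # v)) ! (Suc m + i)) * dg (((a # u) @ (b # v)) ! j))
     = (\<Sum>j<m. \<Sum>i<Suc j. dg ((b # v) ! i) * dg (u ! j))"
    unfolding sum.lessThan_Suc_shift using assms
    by (auto simp: nth_append intro!: sum.cong)
  also have "\<dots> = dg b * wdeg dg u + ?s"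
    by (simp add: sum.lessThan_Suc_shift sum.distrib wd sum_distrib_left del: sum.lessThan_Suc)
  finally have sg: "(\<Sum>j<Suc m. \<Sum>i<j. dg (((a # u) @ (b # v)) ! (Suc m + i)) * dg (((a # u) @ (b # v)) ! j))
     = dg b * wdeg dg u + ?s" .
  have "sigma dg (Suc m) (basis ((a # u) @ (b # v)) :: ('b, 'r) tens) =
      scale (ksign (dg b * wdeg dg u + ?s)) (basis ([a, b] @ ?c))"
    unfolding sigma_def lin_basis sg using assms by simp
  moreover have "sigma dg m (basis (u @ v) :: ('b, 'r) tens) = scale (ksign ?s) (basis ?c)"
    using assms by (auto simp: sigma_def nth_append intro!: arg_cong2[of _ _ _ _ scale] arg_cong[of _ _ ksign] sum.cong)
  moreover have "map_power dg 2 \<mu> (Suc m) (basis ([a, b] @ ?c)) =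
      tensor (\<mu> (basis [a, b])) (map_power dg 2 \<mu> m (basis ?c))"
    using tensor_map_basis[of "[a, b]" 2 dg \<mu> 0 "map_power dg 2 \<mu> m" ?c] by simp
  ultimately show ?thesis
    by (simp add: mult_tpow_def ksign_add module_hom.scale[OF linear_map_map_power] mult.commute
          del: map_power.simps)
qed

section \<open>Sums of words with prescribed exterior part\<close>

text \<open>The offset \<open>c\<close> expresses the index \<open>j - c\<close> without truncated subtraction: the sum is empty for \<open>j < c\<close>.\<close>

definition gsum :: "bool list \<Rightarrow> nat \<Rightarrow> nat \<Rightarrow> (bool \<times> nat, 'r::comm_ring_1) tens" where
  "gsum es c j = (\<Sum>js\<in>{js. length js = length es \<and> sum_list js + c = j}. basis (zip es js))"

lemma finite_compositions [simp]: "finite {js. length js = n \<and> sum_list js + c = (j::nat)}"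
proof (rule finite_subset)
  show "{js. length js = n \<and> sum_list js + c = j} \<subseteq> {js. set js \<subseteq> {..j} \<and> length js = n}"
    using member_le_sum_list by fastforce
qed (simp add: finite_lists_length_eq)

lemma gsum_Suc_Suc [simp]: "gsum es (Suc c) (Suc j) = gsum es c j"
  by (simp add: gsum_def)

lemma gsum_Suc_0 [simp]: "gsum es (Suc c) 0 = 0"
  by (simp add: gsum_def)

lemma gsum_Nil: "gsum [] 0 j = (if j = 0 then basis [] else 0)"
proof -
  have "{js. js = [] \<and> sum_list js = j} = (if j = 0 then {[]} else {})" by auto
  then show ?thesis by (simp add: gsum_def)
qed

text \<open>Sorts the index tuples by their first entry \<open>l\<close>; the subtraction
  \<open>j - l\<close> is exact because \<open>l \<le> j\<close>.\<close>

lemma gsum_Cons: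
  "(gsum (e # es) 0 j :: (bool \<times> nat, 'r::comm_ring_1) tens) =
    (\<Sum>l\<le>j. tensor (basis [(e, l)]) (gsum es 0 (j - l)))"
proof -
  have "(\<Sum>l\<le>j. tensor (basis [(e, l)]) (gsum es 0 (j - l)) :: (bool \<times> nat, 'r) tens)
      = (\<Sum>(l, js)\<in>(SIGMA l:{..j}. {js. length js = length es \<and> sum_list js + 0 = j - l}). basis ((e, l) # zip es js))"
    by (subst sum.Sigma[symmetric]) (simp_all only: finite_compositions, simp_all add: gsum_def tensor_sum_right)
  also have "\<dots> = gsum (e # es) 0 j"
    unfolding gsum_def
    by (rule sum.reindex_bij_witness[where j = "\<lambda>(l, js). l # js" and i = "\<lambda>js. (hd js, tl js)"])
       (auto simp: length_Suc_conv)
  finally show ?thesis by simp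
qed

lemma gsum_single: "gsum [e] 0 j = basis [(e, j)]"
proof -
  have "{js. length js = Suc 0 \<and> sum_list js = j} = {[j]}" by (auto simp: length_Suc_conv)
  then show ?thesis by (simp add: gsum_def)
qed

text \<open>Divided powers have even degree and \<open>v\<close> has odd degree, so Koszul signs see
  only the number of letters \<open>v\<close>, never the indices.\<close>

lemma odd_wdeg_zip:
  assumes "\<And>x. odd (dg x) = fst x" "length js = length es"
  shows "odd (wdeg dg (zip es js)) = odd (count_list es True)"
  using assms(2)
proof (induction js es rule: list_induct2)
  case (Cons j js e es)
  then show ?case using assms(1)[of "(e, j)"] by (auto simp: wdeg_def)
qed (simp add: wdeg_def)

lemma ksign_mult_wdeg_zip:
  assumes "\<And>x. odd (dg x) = fst x" "length js = length es"
  shows "ksign (k * wdeg dg (zip es js)) = ksign (k * int (count_list es True))"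
  using odd_wdeg_zip[OF assms] by (auto simp: ksign_def)

text \<open>Replacing the index \<open>y\<close> in position \<open>s\<close> by all tuples
  \<open>ls\<close> with \<open>sum_list ls + c' = y\<close> meets every index tuple of the longer
  word exactly once, since \<open>y\<close> can be recovered from \<open>ls\<close>. Hence the
  offsets add, and the sign depends only on the \<open>v\<close>'s in \<open>es1\<close>.\<close>

lemma insert_map_gsum:
  fixes f :: "(bool \<times> nat, 'r::comm_ring_1) tens \<Rightarrow> (bool \<times> nat, 'r) tens"
  assumes dg: "\<And>x. odd (dg x) = fst x"
    and f: "\<And>j. f (basis [(b, j)]) = (\<Sum>us\<in>U. gsum us c' j)"
    and s: "s = length es1"
  shows "insert_map dg s 1 k f (gsum (es1 @ b # es2) c j) =
    scale (ksign (k * int (count_list es1 True))) (\<Sum>us\<in>U. gsum (es1 @ us @ es2) (c + c') j)"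
proof -
  let ?J = "{js. length js = length (es1 @ b # es2) \<and> sum_list js + c = j}"
  let ?L = "\<lambda>us y. {ls. length ls = length us \<and> sum_list ls + c' = y}"
  let ?h = "\<lambda>us js. basis (zip (es1 @ us @ es2) js) :: (bool \<times> nat, 'r) tens"
  let ?g = "\<lambda>js ls. take s js @ ls @ drop (Suc s) js"
  let ?\<epsilon> = "ksign (k * int (count_list es1 True)) :: 'r"
  have decomp: "\<exists>xs y zs. js = xs @ y # zs \<and> length xs = s \<and> length zs = length es2" if J: "js \<in> ?J" for js
    using J s id_take_nth_drop[of s js]
    by (intro exI[of _ "take s js"] exI[of _ "js ! s"] exI[of _ "drop (Suc s) js"]) auto
  have word: "insert_map dg s 1 k f (basis (zip (es1 @ b # es2) js)) =
      scale ?\<epsilon> (\<Sum>us\<in>U. \<Sum>ls\<in>?L us (js ! s). ?h us (?g js ls))" if J: "js \<in> ?J" for js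
  proof -
    obtain xs y zs where js: "js = xs @ y # zs" "length xs = s" "length zs = length es2"
      using decomp[OF J] by blast
    have "insert_map dg s 1 k f (basis (zip (es1 @ b # es2) js)) =
        insert_map dg s 1 k f (basis (zip es1 xs @ [(b, y)] @ zip es2 zs))"
      using js s by simp
    also have "\<dots> = scale ?\<epsilon> (tensor (basis (zip es1 xs)) (tensor (f (basis [(b, y)])) (basis (zip es2 zs))))"
      using js s by (subst insert_map_basis) (auto simp: ksign_mult_wdeg_zip[where js=xs, OF dg])
    also have "\<dots> = scale ?\<epsilon> (\<Sum>us\<in>U. \<Sum>ls\<in>?L us y. basis (zip es1 xs @ zip us ls @ zip es2 zs))"
      by (simp add: f gsum_def tensor_sum_left tensor_sum_right)
    also have "\<dots> = scale ?\<epsilon> (\<Sum>us\<in>U. \<Sum>ls\<in>?L us (js ! s). ?h us (?g js ls))"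
    proof -
      have "take s js = xs" "js ! s = y" "drop (Suc s) js = zs"
        using js by auto
      then show ?thesis
        using s js(2) by (auto intro!: arg_cong[of _ _ "scale _"] sum.cong)
    qed
    finally show ?thesis .
  qed
  have "insert_map dg s 1 k f (gsum (es1 @ b # es2) c j) =
      (\<Sum>js\<in>?J. insert_map dg s 1 k f (basis (zip (es1 @ b # es2) js)))"
    unfolding gsum_def by (rule module_hom.sum[OF linear_map_insert_map])
  also have "\<dots> = (\<Sum>js\<in>?J. scale ?\<epsilon> (\<Sum>us\<in>U. \<Sum>ls\<in>?L us (js ! s). ?h us (?g js ls)))"
    by (rule sum.cong[OF refl word])
  also have "\<dots> = scale ?\<epsilon> (\<Sum>js\<in>?J. \<Sum>us\<in>U. \<Sum>ls\<in>?L us (js ! s). ?h us (?g js ls))"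
    by (rule scale.scale_sum_right[symmetric])
  also have "(\<Sum>js\<in>?J. \<Sum>us\<in>U. \<Sum>ls\<in>?L us (js ! s). ?h us (?g js ls)) =
      (\<Sum>us\<in>U. \<Sum>js\<in>?J. \<Sum>ls\<in>?L us (js ! s). ?h us (?g js ls))"
    by (rule sum.swap)
  also have "\<dots> = (\<Sum>us\<in>U. gsum (es1 @ us @ es2) (c + c') j)"
  proof (rule sum.cong[OF refl])
    fix us :: "bool list"
    let ?n = "length us"
    have "(\<Sum>js\<in>?J. \<Sum>ls\<in>?L us (js ! s). ?h us (?g js ls)) =
       (\<Sum>(js, ls)\<in>(SIGMA js:?J. ?L us (js ! s)). ?h us (?g js ls))"
      by (rule sum.Sigma) (simp_all only: finite_compositions, simp)
    also have "\<dots> = gsum (es1 @ us @ es2) (c + c') j"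
      unfolding gsum_def
    \<comment> \<open>The inverse fuses the block of length \<open>?n\<close> starting at position
      \<open>s\<close> into the single index from which it arose.\<close>
    proof (rule sum.reindex_bij_witness[where j = "\<lambda>(js, ls). ?g js ls" and
            i = "\<lambda>js. (take s js @ (sum_list (take ?n (drop s js)) + c') # drop (s + ?n) js,
                      take ?n (drop s js))"], goal_cases)
      case (1 a)
      obtain js ls where a: "a = (js, ls)" by (cases a)
      then have J: "js \<in> ?J" "length ls = ?n" "sum_list ls + c' = js ! s" using 1 by auto
      then obtain xs y zs where js: "js = xs @ y # zs" "length xs = s"
        using decomp by blast
      then have "take s js = xs" "js ! s = y" "drop (Suc s) js = zs"
        by auto
      then show ?case using J js by (simp add: a)
    next
      case (2 a)
      obtain js ls where a: "a = (js, ls)" by (cases a)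
      then have J: "js \<in> ?J" "length ls = ?n" "sum_list ls + c' = js ! s" using 2 by auto
      then obtain xs y zs where js: "js = xs @ y # zs" "length xs = s" "length zs = length es2"
        using decomp by blast
      then have "take s js = xs" "js ! s = y" "drop (Suc s) js = zs"
        by auto
      then show ?case using J js s by (simp add: a)
    next
      case (3 js)
      define xs ls zs where "xs = take s js" "ls = take ?n (drop s js)" "zs = drop (s + ?n) js"
      then have js: "js = xs @ ls @ zs"
        by (metis add.commute append_take_drop_id drop_drop)
      have len: "length xs = s" "length ls = ?n" using 3 s xs_ls_zs_def by auto
      have "take s js = xs" "take ?n (drop s js) = ls" "drop (s + ?n) js = zs"
        using js len by auto
      then show ?case using js len by simp
    next
      case (4 js)
      define xs ls zs where "xs = take s js" "ls = take ?n (drop s js)" "zs = drop (s + ?n) js"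
      then have js: "js = xs @ ls @ zs"
        by (metis add.commute append_take_drop_id drop_drop)
      have len: "length xs = s" "length ls = ?n" "length zs = length es2"
        using 4 s xs_ls_zs_def by auto
      have *: "take s js = xs" "take ?n (drop s js) = ls" "drop (s + ?n) js = zs"
        using js len by auto
      have "(xs @ (sum_list ls + c') # zs) ! s = sum_list ls + c'"
        using len(1) by auto
      then show ?case unfolding * using js len 4 s by simp
    next
      case (5 a)
      then show ?case by auto
    qed
    finally show "(\<Sum>js\<in>?J. \<Sum>ls\<in>?L us (js ! s). ?h us (?g js ls)) = gsum (es1 @ us @ es2) (c + c') j" .
  qed
  finally show ?thesis .
qed

section \<open>Products\<close>

text \<open>Collecting the terms with \<open>l + l' = s\<close> gives \<open>h s\<close> the
  coefficient \<open>(a + b) choose a\<close> by Vandermonde, independently of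
  \<open>s\<close>.\<close>

lemma vandermonde_convolution:
  fixes h :: "nat \<Rightarrow> ('a \<Rightarrow>\<^sub>0 'r::comm_ring_1)"
  shows "(\<Sum>l\<le>a. \<Sum>l'\<le>b. scale (of_nat (((l + l') choose l) * ((a - l + (b - l')) choose (a - l)))) (h (l + l')))
     = scale (of_nat ((a + b) choose a)) (\<Sum>s\<le>a + b. h s)"
proof -
  let ?t = "\<lambda>s l. scale (of_nat ((s choose l) * ((a + b - s) choose (a - l)))) (h s)"
  have "(\<Sum>l\<le>a. \<Sum>l'\<le>b. scale (of_nat (((l + l') choose l) * ((a - l + (b - l')) choose (a - l)))) (h (l + l')))
      = (\<Sum>l\<le>a. \<Sum>s\<le>a + b. ?t s l)"
  proof (rule sum.cong[OF refl])
    fix l assume "l \<in> {..a}"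
    then have l: "l \<le> a" by simp
    have "(\<Sum>l'\<le>b. scale (of_nat (((l + l') choose l) * ((a - l + (b - l')) choose (a - l)))) (h (l + l')))
        = (\<Sum>s\<in>{l..l + b}. ?t s l)"
      by (rule sum.reindex_bij_witness[where j = "\<lambda>l'. l + l'" and i = "\<lambda>s. s - l"]) (use l in auto)
    also have "\<dots> = (\<Sum>s\<le>a + b. ?t s l)"
      \<comment> \<open>Outside \<open>{l..l + b}\<close> one binomial vanishes: the first for
        \<open>s < l\<close>, the second for \<open>s > l + b\<close>, where
        \<open>a + b - s < a - l\<close>.\<close>
      by (rule sum.mono_neutral_left) (use l in \<open>auto simp: not_le binomial_eq_0\<close>)
    finally show "(\<Sum>l'\<le>b. scale (of_nat (((l + l') choose l) * ((a - l + (b - l')) choose (a - l)))) (h (l + l')))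
        = (\<Sum>s\<le>a + b. ?t s l)" .
  qed
  also have "\<dots> = (\<Sum>s\<le>a + b. \<Sum>l\<le>a. ?t s l)"
    by (rule sum.swap)
  also have "\<dots> = (\<Sum>s\<le>a + b. scale (of_nat ((a + b) choose a)) (h s))"
  proof (rule sum.cong[OF refl])
    fix s assume "s \<in> {..a + b}"
    then show "(\<Sum>l\<le>a. ?t s l) = scale (of_nat ((a + b) choose a)) (h s)"
      using vandermonde[of s "a + b - s" a]
      by (simp only: scale.scale_sum_left[symmetric] of_nat_sum[symmetric]) simp
  qed
  finally show ?thesis by (simp add: scale.scale_sum_right)
qed

text \<open>The sign from moving \<open>es'\<close> past \<open>es\<close> factor by factor, with value \<open>0\<close> when both words contain a \<open>v\<close> in
  the same position.\<close>

fun shuffle_sign :: "bool list \<Rightarrow> bool list \<Rightarrow> 'r::comm_ring_1" where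
  "shuffle_sign (e # es) (e' # es') = (if e \<and> e' then 0 else
     ksign (of_bool e' * int (count_list es True)) * shuffle_sign es es')"
| "shuffle_sign _ _ = 1"

text \<open>The signs depend only on the parities of \<open>d1\<close> and \<open>d2\<close>, so the
  degrees stay abstract. There is no sign in \<open>mu_basis\<close> because the divided powers,
  being even, pass \<open>v\<close> freely.\<close>

locale exterior_divided_power =
  fixes d1 d2 :: int and dg :: "bool \<times> nat \<Rightarrow> int"
    and \<mu> :: "(bool \<times> nat, 'r::comm_ring_1) tens \<Rightarrow> (bool \<times> nat, 'r) tens"
  assumes dg_eq: "dg (e, j) = of_bool e * d1 + int j * d2"
    and odd_d1: "odd d1" and even_d2: "even d2"
    and linear_mu: "linear_map \<mu>"
    and mu_basis: "\<mu> (basis [(e, a), (e', b)]) =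
      (if e \<and> e' then 0 else scale (of_nat ((a + b) choose a)) (basis [(e \<or> e', a + b)]))"
begin

lemma odd_dg: "odd (dg x) = fst x"
  using odd_d1 even_d2 by (cases x) (auto simp: dg_eq)

text \<open>The sign in \<open>mult_tpow_Cons\<close> is the same for all words with a given
  exterior part, so it can be pulled out of the sums over indices.\<close>

lemma mult_tpow_Cons_gsum:
  assumes "length es = m" "length es' = m"
  shows "mult_tpow dg (Suc m) \<mu> (tensor (tensor (basis [x]) (gsum es 0 i)) (tensor (basis [y]) (gsum es' 0 k)))
    = scale (ksign (of_bool (fst y) * int (count_list es True)))
        (tensor (\<mu> (basis [x, y])) (mult_tpow dg m \<mu> (tensor (gsum es 0 i) (gsum es' 0 k))))"
proof -
  have word: "mult_tpow dg (Suc m) \<mu> (basis (x # zip es js @ y # zip es' js')) =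
    scale (ksign (of_bool (fst y) * int (count_list es True)))
        (tensor (\<mu> (basis [x, y])) (mult_tpow dg m \<mu> (basis (zip es js @ zip es' js'))))"
    if "length js = length es" "length js' = length es'" for js js'
  proof -
    have "(ksign (dg y * wdeg dg (zip es js)) :: 'r) = ksign (of_bool (fst y) * int (count_list es True))"
      using odd_wdeg_zip[of dg js es, OF odd_dg] that odd_dg[of y] by (auto simp: ksign_def)
    then show ?thesis
      using mult_tpow_Cons[of "zip es js" m "zip es' js'" dg \<mu> x y] that assms by simp
  qed
  show ?thesis
    unfolding gsum_def
    by (simp add: tensor_sum_left tensor_sum_right module_hom.sum[OF linear_map_mult_tpow]
         word scale.scale_sum_right)
qed

text \<open>Induction on the number of factors: the first factors contribute one binomial
  coefficient, the induction hypothesis another, and Vandermonde's convolution merges the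
  two.\<close>

lemma mult_tpow_gsum:
  assumes "length es = m" "length es' = m"
  shows "mult_tpow dg m \<mu> (tensor (gsum es 0 a) (gsum es' 0 b)) =
    scale (shuffle_sign es es' * of_nat ((a + b) choose a)) (gsum (map2 (\<or>) es es') 0 (a + b))"
  using assms
proof (induction m arbitrary: es es' a b)
  case 0
  then show ?case by (auto simp: gsum_Nil module_hom.zero[OF linear_map_mult_tpow])
next
  case (Suc m)
  then obtain e fs e' fs' where es: "es = e # fs" "es' = e' # fs'" "length fs = m" "length fs' = m"
    by (auto simp: length_Suc_conv)
  let ?\<epsilon> = "ksign (of_bool e' * int (count_list fs True)) :: 'r"
  let ?h = "\<lambda>s. tensor (basis [(e \<or> e', s)]) (gsum (map2 (\<or>) fs fs') 0 (a + b - s)) :: (bool \<times> nat, 'r) tens"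
  have "mult_tpow dg (Suc m) \<mu> (tensor (gsum es 0 a) (gsum es' 0 b)) =
     (\<Sum>l\<le>a. \<Sum>l'\<le>b. scale ?\<epsilon> (tensor (\<mu> (basis [(e, l), (e', l')]))
        (scale (shuffle_sign fs fs' * of_nat ((a - l + (b - l')) choose (a - l)))
          (gsum (map2 (\<or>) fs fs') 0 (a - l + (b - l'))))))"
    unfolding es(1,2) gsum_Cons using es(3,4)
    by (simp only: tensor_sum_left module_hom.sum[OF linear_map_mult_tpow],
        simp add: tensor_sum_right module_hom.sum[OF linear_map_mult_tpow] mult_tpow_Cons_gsum Suc.IH)
  also have "\<dots> = (if e \<and> e' then 0 else scale (?\<epsilon> * shuffle_sign fs fs')
     (\<Sum>l\<le>a. \<Sum>l'\<le>b. scale (of_nat (((l + l') choose l) * ((a - l + (b - l')) choose (a - l)))) (?h (l + l'))))"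
    by (simp add: mu_basis scale.scale_sum_right mult_ac)
  also have "\<dots> = scale (shuffle_sign es es' * of_nat ((a + b) choose a)) (gsum (map2 (\<or>) es es') 0 (a + b))"
    unfolding vandermonde_convolution[where h = ?h] by (simp add: es gsum_Cons mult_ac)
  finally show ?case .
qed

end

section \<open>The coproduct and its iterates\<close>

text \<open>The exterior parts of the terms of \<open>f^m(v^e \<gamma>_j)\<close>: the words of
  length \<open>m\<close> with \<open>e\<close> letters \<open>v\<close>. The recursion follows the
  position of the \<open>v\<close>, so that sums over these words can be peeled from the
  front.\<close>

fun weight_words :: "nat \<Rightarrow> bool \<Rightarrow> bool list set" where
  "weight_words m False = {replicate m False}"
| "weight_words 0 True = {}"
| "weight_words (Suc m) True = insert (True # replicate m False) ((#) False ` weight_words m True)"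

lemma finite_weight_words [simp]: "finite (weight_words m e)"
  by (induction m e rule: weight_words.induct) auto

lemma length_weight_words: "es \<in> weight_words m e \<Longrightarrow> length es = m"
  by (induction m e arbitrary: es rule: weight_words.induct) auto

lemma count_replicate_False [simp]: "count_list (replicate m False) True = 0"
  by (induction m) auto

lemma count_weight_words: "es \<in> weight_words m e \<Longrightarrow> count_list es True = of_bool e"
  by (induction m e arbitrary: es rule: weight_words.induct) auto

lemma sum_weight_words_Suc:
  "(\<Sum>es\<in>weight_words (Suc m) True. h es) =
    h (True # replicate m False) + (\<Sum>es\<in>weight_words m True. h (False # es))"
proof -
  have "True # replicate m False \<notin> (#) False ` weight_words m True" by auto
  then show ?thesis by (simp add: sum.reindex)
qed

lemma weight_words_2:
  "weight_words 2 False = {[False, False]}"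
  "weight_words 2 True = {[True, False], [False, True]}"
  by (auto simp: numeral_2_eq_2)

lemma shuffle_sign_zero_left: "length es = m \<Longrightarrow> shuffle_sign (replicate m False) es = 1"
  by (induction m arbitrary: es) (auto simp: length_Suc_conv)

lemma shuffle_sign_zero_right: "length es = m \<Longrightarrow> shuffle_sign es (replicate m False) = 1"
  by (induction m arbitrary: es) (auto simp: length_Suc_conv)

lemma map2_or_zero_left: "length es = m \<Longrightarrow> map2 (\<or>) (replicate m False) es = es"
  by (induction m arbitrary: es) (auto simp: length_Suc_conv)

lemma map2_or_zero_right: "length es = m \<Longrightarrow> map2 (\<or>) es (replicate m False) = es"
  by (induction m arbitrary: es) (auto simp: length_Suc_conv)

text \<open>The one \<open>v\<close> in \<open>es\<close> meets a \<open>v\<close> of the full word;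
  for \<open>m = 0\<close> there is no such \<open>es\<close>.\<close>

lemma shuffle_sign_overlap_left: "es \<in> weight_words m True \<Longrightarrow> shuffle_sign es (replicate m True) = 0"
  by (induction m arbitrary: es) auto

lemma shuffle_sign_overlap_right: "es \<in> weight_words m True \<Longrightarrow> shuffle_sign (replicate m True) es = 0"
  by (induction m arbitrary: es) auto

text \<open>This is \<open>f^m(v)^2 = 0\<close>: \<open>f^m(v)\<close> is the sum of the
  \<open>m\<close> placements of \<open>v\<close>, which square to 0 and anticommute. An arbitrary
  \<open>h\<close> lets the induction put a letter in front.\<close>

lemma shuffle_sign_cancel:
  fixes h :: "bool list \<Rightarrow> ('a \<Rightarrow>\<^sub>0 'r::comm_ring_1)"
  shows "(\<Sum>es\<in>weight_words m True. \<Sum>es'\<in>weight_words m True.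
     scale (shuffle_sign es es') (h (map2 (\<or>) es es'))) = 0"
proof (induction m arbitrary: h)
  case (Suc m)
  \<comment> \<open>\<open>A\<close> has the leading \<open>v\<close> in the left word,
    \<open>B\<close> in the right word. In \<open>B\<close> the leading \<open>v\<close> crosses one
    other \<open>v\<close>, so the two sums cancel.\<close>
  have A: "(\<Sum>es'\<in>weight_words m True. scale (shuffle_sign (replicate m False) es')
        (h (True # map2 (\<or>) (replicate m False) es'))) = (\<Sum>es\<in>weight_words m True. h (True # es))"
    by (intro sum.cong refl)
       (simp add: shuffle_sign_zero_left map2_or_zero_left length_weight_words)
  have B: "(\<Sum>es\<in>weight_words m True. scale (ksign (int (count_list es True)) * shuffle_sign es (replicate m False))
        (h (True # map2 (\<or>) es (replicate m False)))) = - (\<Sum>es\<in>weight_words m True. h (True # es))"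
    unfolding sum_negf[symmetric]
    by (intro sum.cong refl)
       (simp add: shuffle_sign_zero_right map2_or_zero_right length_weight_words count_weight_words ksign_def)
  show ?case
    using Suc.IH[of "\<lambda>es. h (False # es)"] A B
    by (simp add: sum_weight_words_Suc sum.distrib del: weight_words.simps(3))
qed simp

text \<open>The closed form of \<open>f^m(v^e \<gamma>_j)\<close>, matched with the iterated
  coproduct in \<open>iter_coprod_basis\<close>.\<close>

definition coprod :: "nat \<Rightarrow> bool \<Rightarrow> nat \<Rightarrow> (bool \<times> nat, 'r::comm_ring_1) tens" where
  "coprod m e j = (\<Sum>es\<in>weight_words m e. gsum es 0 j)"

section \<open>Values of the two operations on words and on \<open>gsum\<close>\<close>

lemma linear_map_Delta_two [simp]: "linear_map Delta_two"
  by (simp add: Delta_two_def)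

lemma linear_map_Delta_p [simp]: "linear_map (Delta_p p)"
  by (simp add: Delta_p_def)

lemma gsum_pair: "gsum [e, e'] 0 j = (\<Sum>l\<le>j. basis [(e, l), (e', j - l)])"
  by (simp add: gsum_Cons[of e] gsum_single)

lemma Delta_two_basis: "Delta_two (basis [(b, j)]) = (\<Sum>us\<in>weight_words 2 b. gsum us 0 j)"
  by (cases b) (simp_all add: Delta_two_def vgam_def weight_words_2 gsum_pair atLeast0AtMost
     atLeast0_atMost_Suc add.commute del: weight_words.simps)

lemma Delta_two_basis_coprod: "Delta_two (basis [(b, j)]) = coprod 2 b j"
  by (simp add: Delta_two_basis coprod_def)

lemma foldr_vgam_1: "foldr tensor (map (vgam (Suc 0)) ks) (basis []) = basis (zip (replicate (length ks) True) ks)"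
  by (induction ks) (simp_all add: vgam_def)

text \<open>For \<open>e = 1\<close> each tensor factor contains \<open>v^2 = 0\<close>, and
  \<open>p > 0\<close> ensures that there is a factor. The offset 1 encodes the total index
  \<open>j - 1\<close>, with value 0 at \<open>j = 0\<close>.\<close>

lemma Delta_p_basis:
  assumes "p > 0"
  shows "Delta_p p (basis [(b, j)]) = (if b then 0 else gsum (replicate p True) 1 j)"
proof (cases b)
  case True
  have "foldr tensor (map (vgam 2) ks) (basis []) = 0" if "length ks = p" for ks
    using that assms by (cases ks) (simp_all add: vgam_def)
  then show ?thesis
    using True by (auto simp: Delta_p_def numeral_2_eq_2 intro!: sum.neutral)
next
  case False
  then show ?thesis
    by (auto simp: Delta_p_def gsum_def foldr_vgam_1 intro!: sum.cong)
qed

text \<open>Lets the steps of \<open>iter_coprod\<close> be computed by the insertion formula for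
  \<open>gsum\<close>.\<close>

lemma insert_map_0: "insert_map dg 0 a k f = tensor_map dg a f 0 id"
  by (rule ext) (simp add: insert_map_def tensor_map_def[of dg 0] wdeg_def lin_cong_on_basis)

lemma insert_map_Delta_two:
  assumes "\<And>x. odd (dg x) = fst x" "s = length es1"
  shows "insert_map dg s 1 0 Delta_two (gsum (es1 @ b # es2) c j) =
    (\<Sum>us\<in>weight_words 2 b. gsum (es1 @ us @ es2) c j)"
  using insert_map_gsum[OF assms(1) Delta_two_basis assms(2), where k = 0 and ?es2.0 = es2 and c = c and j = j]
  by simp

lemma insert_map_Delta_p:
  assumes "\<And>x. odd (dg x) = fst x" "s = length es1" "p > 0"
  shows "insert_map dg s 1 k (Delta_p p) (gsum (es1 @ b # es2) c j) =
    (if b then 0 else scale (ksign (k * int (count_list es1 True)))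
      (gsum (es1 @ replicate p True @ es2) (Suc c) j))"
  \<comment> \<open>The set of replacing words is empty for the letter \<open>v\<close>, on which
    the operation vanishes, and a single word otherwise.\<close>
  using insert_map_gsum[where f = "Delta_p p" and U = "if b then {} else {replicate p True}" and c' = 1
      and b = b and k = k and ?es2.0 = es2 and c = c and j = j, OF assms(1) _ assms(2)] assms(3)
  by (cases b) (simp_all add: Delta_p_basis)

text \<open>Applying the coproduct to the first factor doubles a leading 1 and splits a leading
  \<open>v\<close> into \<open>v\<close> followed by 1 and 1 followed by \<open>v\<close>; this
  yields each word with \<open>b\<close> letters \<open>v\<close> once.\<close>

lemma iter_coprod_basis:
  assumes "\<And>x. odd (dg x) = fst x"
  shows "iter_coprod dg Delta_two n (basis [(b, j)]) = (coprod (Suc n) b j :: (bool \<times> nat, 'r::comm_ring_1) tens)"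
proof (induction n)
  case 0
  then show ?case by (cases b) (simp_all add: coprod_def gsum_single)
next
  case (Suc n)
  have step: "tensor_map dg 1 Delta_two 0 id (gsum (e # es) 0 j) =
      ((\<Sum>us\<in>weight_words 2 e. gsum (us @ es) 0 j) :: (bool \<times> nat, 'r) tens)" for e es
    using insert_map_Delta_two[OF assms, of 0 "[]" e es 0 j] by (simp add: insert_map_0)
  have "iter_coprod dg Delta_two (Suc n) (basis [(b, j)]) =
      ((\<Sum>es\<in>weight_words (Suc n) b. tensor_map dg 1 Delta_two 0 id (gsum es 0 j)) :: (bool \<times> nat, 'r) tens)"
    by (simp add: Suc coprod_def module_hom.sum[OF linear_map_tensor_map])
  also have "\<dots> = coprod (Suc (Suc n)) b j"
    using step
    by (cases b) (simp_all add: coprod_def sum_weight_words_Suc weight_words_2 add_ac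
        del: weight_words.simps(3) weight_words.simps(1)[of 2], simp_all add: numeral_2_eq_2)
  finally show ?case .
qed

section \<open>Multiplicativity of \<open>f^m\<close> and the derivation property\<close>

context exterior_divided_power
begin

text \<open>If at most one factor contains \<open>v\<close>, one exterior word is trivial and no
  sign arises; if both do, the terms cancel by anticommutation.\<close>

lemma mult_coprod:
  "mult_tpow dg m \<mu> (tensor (coprod m e a) (coprod m e' b)) =
    (if e \<and> e' then 0 else scale (of_nat ((a + b) choose a)) (coprod m (e \<or> e') (a + b)))"
proof -
  have "mult_tpow dg m \<mu> (tensor (coprod m e a) (coprod m e' b)) =
    (\<Sum>es\<in>weight_words m e. \<Sum>es'\<in>weight_words m e'.
      scale (shuffle_sign es es' * of_nat ((a + b) choose a)) (gsum (map2 (\<or>) es es') 0 (a + b)))"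
    unfolding coprod_def
    by (simp only: tensor_sum_left module_hom.sum[OF linear_map_mult_tpow],
        simp only: tensor_sum_right module_hom.sum[OF linear_map_mult_tpow])
       (simp add: mult_tpow_gsum length_weight_words)
  also have "\<dots> = scale (of_nat ((a + b) choose a)) (\<Sum>es\<in>weight_words m e. \<Sum>es'\<in>weight_words m e'.
      scale (shuffle_sign es es') (gsum (map2 (\<or>) es es') 0 (a + b)))"
    by (simp add: scale.scale_sum_right mult.commute)
  also have "\<dots> = (if e \<and> e' then 0 else scale (of_nat ((a + b) choose a)) (coprod m (e \<or> e') (a + b)))"
  proof (cases "e \<and> e'")
    case True
    then show ?thesis by (simp add: shuffle_sign_cancel[where h = "\<lambda>es. gsum es 0 (a + b)"])
  next
    case False
    then show ?thesis
      by (cases e; cases e')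
         (simp_all add: coprod_def shuffle_sign_zero_left shuffle_sign_zero_right map2_or_zero_left
           map2_or_zero_right length_weight_words)
  qed
  finally show ?thesis .
qed

lemma mult_coprod_gsum_True:
  "mult_tpow dg m \<mu> (tensor (coprod m e a) (gsum (replicate m True) 0 b)) =
    (if e then 0 else scale (of_nat ((a + b) choose a)) (gsum (replicate m True) 0 (a + b)))"
  "mult_tpow dg m \<mu> (tensor (gsum (replicate m True) 0 a) (coprod m e b)) =
    (if e then 0 else scale (of_nat ((a + b) choose a)) (gsum (replicate m True) 0 (a + b)))"
  by (cases e; simp add: coprod_def tensor_sum_left tensor_sum_right module_hom.sum[OF linear_map_mult_tpow]
       mult_tpow_gsum length_weight_words shuffle_sign_overlap_left shuffle_sign_overlap_right
       shuffle_sign_zero_left shuffle_sign_zero_right map2_or_zero_left map2_or_zero_right)+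

lemma wdeg_zip:
  assumes "length js = length es"
  shows "wdeg dg (zip es js) = int (count_list es True) * d1 + int (sum_list js) * d2"
  using assms by (induction js es rule: list_induct2) (auto simp: wdeg_def dg_eq algebra_simps)

text \<open>For \<open>j < c\<close> the sum is empty and lies in every degree, hence the premise
  \<open>c \<le> j\<close> in the degree condition.\<close>

lemma gsum_in_tpow_deg:
  assumes "length es = m" "c \<le> j \<Longrightarrow> int (count_list es True) * d1 + (int j - int c) * d2 = d"
  shows "gsum es c j \<in> tpow_deg dg m d"
  unfolding gsum_def
proof (intro tpow_deg_sum basis_in_tpow_deg)
  fix js assume js: "js \<in> {js. length js = length es \<and> sum_list js + c = j}"
  then show "length (zip es js) = m" using assms(1) by simp
  have "c \<le> j" "int (sum_list js) = int j - int c" using js by auto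
  then show "wdeg dg (zip es js) = d"
    using js wdeg_zip[of js es] assms(2) by simp
qed

lemma wdeg_single: "wdeg dg [(e, j)] = of_bool e * d1 + int j * d2"
  by (simp add: wdeg_def dg_eq)

lemma coprod_in_tpow_deg: "coprod m e j \<in> tpow_deg dg m (wdeg dg [(e, j)])"
  unfolding coprod_def
  by (intro tpow_deg_sum gsum_in_tpow_deg) (auto simp: length_weight_words count_weight_words wdeg_single)

text \<open>Covers both the coproduct itself, with \<open>m = 2\<close>, and the iterate
  \<open>f^m\<close> in the derivation property.\<close>

lemma algebra_mapI:
  assumes "linear_map f" and f: "\<And>e j. f (basis [(e, j)]) = coprod m e j"
  shows "algebra_map dg m \<mu> (mult_tpow dg m \<mu>) f"
  unfolding algebra_map_def
proof (intro conjI ballI HomI[OF assms(1)])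
  fix w :: "(bool \<times> nat) list" assume "length w = 1"
  then obtain e j where "w = [(e, j)]" by (auto simp: length_Suc_conv)
  then show "f (basis w) \<in> tpow_deg dg m (wdeg dg w + 0)"
    using coprod_in_tpow_deg by (simp add: f)
next
  fix x :: "(bool \<times> nat, 'r) tens" assume "x \<in> tpow 2"
  then show "f (\<mu> x) = mult_tpow dg m \<mu> (tensor_map dg 1 f 0 f x)"
  proof (rule linear_map_eq_on_tpow[rotated 2])
    show "linear_map (\<lambda>x. f (\<mu> x))"
      by (rule linear_map_comp[OF assms(1) linear_mu])
    show "linear_map (\<lambda>x. mult_tpow dg m \<mu> (tensor_map dg 1 f 0 f x))"
      by (rule linear_map_comp[OF linear_map_mult_tpow linear_map_tensor_map])
    fix w :: "(bool \<times> nat) list" assume "length w = 2"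
    then obtain e a e' b where w: "w = [(e, a)] @ [(e', b)]"
      by (auto simp: length_Suc_conv numeral_2_eq_2)
    have "f (\<mu> (basis w)) = (if e \<and> e' then 0 else scale (of_nat ((a + b) choose a)) (coprod m (e \<or> e') (a + b)))"
      by (simp add: w mu_basis f module_hom.scale[OF assms(1)] module_hom.zero[OF assms(1)])
    also have "\<dots> = mult_tpow dg m \<mu> (tensor_map dg 1 f 0 f (basis w))"
      unfolding w by (subst tensor_map_basis) (simp_all add: f mult_coprod)
    finally show "f (\<mu> (basis w)) = mult_tpow dg m \<mu> (tensor_map dg 1 f 0 f (basis w))" .
  qed
qed

text \<open>The operation creates \<open>m\<close> letters \<open>v\<close> and lowers the total
  index by one, so its degree is \<open>m * d1 - d2\<close>.\<close>

lemma is_derivation_Delta_p: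
  assumes "m > 0" and "int m * d1 - d2 = k" and f: "linear_map f" "\<And>e j. f (basis [(e, j)]) = coprod m e j"
  shows "(Delta_p m :: (bool \<times> nat, 'r) tens \<Rightarrow> (bool \<times> nat, 'r) tens) \<in> Hom dg k 1 m"
    "is_derivation dg m \<mu> (mult_tpow dg m \<mu>) f f k (Delta_p m)"
proof -
  let ?D = "Delta_p m :: (bool \<times> nat, 'r) tens \<Rightarrow> (bool \<times> nat, 'r) tens"
  note D = Delta_p_basis[OF assms(1)]
  show Hom: "?D \<in> Hom dg k 1 m"
  proof (rule HomI)
    fix w :: "(bool \<times> nat) list" assume "length w = 1"
    then obtain e j where w: "w = [(e, j)]" by (auto simp: length_Suc_conv)
    have "count_list (replicate m True) True = m" by (induction m) auto
    then have "(gsum (replicate m True) 1 j :: (bool \<times> nat, 'r) tens) \<in> tpow_deg dg m (int j * d2 + k)"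
      using assms(2) by (intro gsum_in_tpow_deg) (auto simp: algebra_simps)
    then show "?D (basis w) \<in> tpow_deg dg m (wdeg dg w + k)"
      by (simp add: w D wdeg_single)
  qed simp
  have "?D (\<mu> x) = mult_tpow dg m \<mu> (tensor_map dg 1 f k ?D x + tensor_map dg 1 ?D 0 f x)" if "x \<in> tpow 2" for x
    using _ _ that
  proof (rule linear_map_eq_on_tpow)
    show "linear_map (\<lambda>x. ?D (\<mu> x))"
      by (rule linear_map_comp[OF linear_map_Delta_p linear_mu])
    show "linear_map (\<lambda>x. mult_tpow dg m \<mu> (tensor_map dg 1 f k ?D x + tensor_map dg 1 ?D 0 f x))"
      by (intro linear_map_comp[OF linear_map_mult_tpow] linear_map_add linear_map_tensor_map)
    fix w :: "(bool \<times> nat) list" assume "length w = 2"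
    then obtain e a e' b where w: "w = [(e, a)] @ [(e', b)]"
      by (auto simp: length_Suc_conv numeral_2_eq_2)
    let ?G = "\<lambda>c j. gsum (replicate m True) c j :: (bool \<times> nat, 'r) tens"
    have "?D (\<mu> (basis w)) = (if e \<or> e' then 0 else scale (of_nat ((a + b) choose a)) (?G 1 (a + b)))"
      by (simp add: w mu_basis D module_hom.scale[OF linear_map_Delta_p] module_hom.zero[OF linear_map_Delta_p])
    \<comment> \<open>Pascal's rule for positive \<open>a\<close> and \<open>b\<close>; if one of
      them is 0, the summand in which the operation is applied to \<open>\<gamma>_0\<close>
      vanishes.\<close>
    also have "\<dots> = (if e \<or> e' then 0 else
        mult_tpow dg m \<mu> (tensor (coprod m False a) (?G 1 b)) + mult_tpow dg m \<mu> (tensor (?G 1 a) (coprod m False b)))"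
      by (cases a; cases b) (simp_all add: mult_coprod_gsum_True module_hom.zero[OF linear_map_mult_tpow]
            scale.scale_left_distrib[symmetric] add_ac)
    also have "\<dots> = mult_tpow dg m \<mu> (tensor_map dg 1 f k ?D (basis w) + tensor_map dg 1 ?D 0 f (basis w))"
    proof -
      have "mult_tpow dg m \<mu> (tensor (coprod m True a) (?G 1 b)) = 0"
        by (cases b) (simp_all add: mult_coprod_gsum_True module_hom.zero[OF linear_map_mult_tpow])
      moreover have "mult_tpow dg m \<mu> (tensor (?G 1 a) (coprod m True b)) = 0"
        by (cases a) (simp_all add: mult_coprod_gsum_True module_hom.zero[OF linear_map_mult_tpow])
      \<comment> \<open>The Koszul sign in \<open>f \<otimes> \<Delta>_m\<close> is trivial for
        \<open>e = 0\<close> because \<open>d2\<close> is even; for \<open>e = 1\<close> it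
        multiplies a product that is zero.\<close>
      ultimately show ?thesis
        unfolding w using even_d2
        by (cases e; cases e')
           (simp_all add: tensor_map_basis[of "[(_, _)]", simplified] f D module_hom.add[OF linear_map_mult_tpow]
             module_hom.scale[OF linear_map_mult_tpow] module_hom.zero[OF linear_map_mult_tpow] wdeg_single)
    qed
    finally show "?D (\<mu> (basis w)) = mult_tpow dg m \<mu> (tensor_map dg 1 f k ?D (basis w) + tensor_map dg 1 ?D 0 f (basis w))" .
  qed
  then show "is_derivation dg m \<mu> (mult_tpow dg m \<mu>) f f k ?D"
    using algebra_mapI[OF f] Hom by (simp add: is_derivation_def)
qed

end

section \<open>The Hopf algebra structure\<close>

definition unit_map :: "(bool \<times> nat, 'r::comm_ring_1) tens \<Rightarrow> (bool \<times> nat, 'r) tens" where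
  "unit_map = lin (\<lambda>w. if w = [] then basis [(False, 0)] else 0)"

definition counit :: "(bool \<times> nat, 'r::comm_ring_1) tens \<Rightarrow> (bool \<times> nat, 'r) tens" where
  "counit = lin (\<lambda>w. if w = [(False, 0)] then basis [] else 0)"

text \<open>The multiplicative extension of \<open>v\<close> to \<open>-v\<close> and
  \<open>\<gamma>_j\<close> to \<open>(-1)^j \<gamma>_j\<close>.\<close>

definition antipode :: "(bool \<times> nat, 'r::comm_ring_1) tens \<Rightarrow> (bool \<times> nat, 'r) tens" where
  "antipode = lin (\<lambda>w. case w of [(e, j)] \<Rightarrow> scale ((- 1) ^ (of_bool e + j)) (basis [(e, j)]) | _ \<Rightarrow> 0)"

lemma linear_map_structure [simp]: "linear_map unit_map" "linear_map counit" "linear_map antipode"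
  by (simp_all add: unit_map_def counit_def antipode_def)

lemma tensor_map_pair: "tensor_map dg 1 f 0 g (basis [x, y]) = tensor (f (basis [x])) (g (basis [y]))"
  using tensor_map_basis[of "[x]" 1 dg f 0 g "[y]"] by simp

text \<open>The expansion of \<open>(1 - 1)^j\<close>; the second form follows by reflecting
  \<open>l\<close> to \<open>j - l\<close>. They are the coefficients in the two antipode
  laws.\<close>

lemma sum_alternating_choose:
  "(\<Sum>l\<le>j. (- 1) ^ l * of_nat (j choose l)) = (of_bool (j = 0) :: 'r::comm_ring_1)"
  "(\<Sum>l\<le>j. (- 1) ^ (j - l) * of_nat (j choose l)) = (of_bool (j = 0) :: 'r::comm_ring_1)"
proof -
  show 1: "(\<Sum>l\<le>j. (- 1) ^ l * of_nat (j choose l)) = (of_bool (j = 0) :: 'r)"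
    using choose_alternating_sum[of j, where 'a = 'r] by (cases "j = 0") auto
  have "(\<Sum>l\<le>j. (- 1) ^ (j - l) * of_nat (j choose l)) = (\<Sum>l\<le>j. (- 1) ^ l * of_nat (j choose l) :: 'r)"
    by (rule sum.reindex_bij_witness[where i = "\<lambda>l. j - l" and j = "\<lambda>l. j - l"])
       (auto simp: binomial_symmetric[symmetric])
  with 1 show "(\<Sum>l\<le>j. (- 1) ^ (j - l) * of_nat (j choose l)) = (of_bool (j = 0) :: 'r)" by simp
qed

lemma length_1E:
  assumes "length (w :: (bool \<times> nat) list) = 1" obtains e j where "w = [(e, j)]"
  using assms by (auto simp: length_Suc_conv)

lemma length_2E:
  assumes "length (w :: (bool \<times> nat) list) = 2" obtains e a e' b where "w = [(e, a), (e', b)]"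
  using assms by (auto simp: length_Suc_conv numeral_2_eq_2)

lemma length_3E:
  assumes "length (w :: (bool \<times> nat) list) = 3" obtains e1 a e2 b e3 c where "w = [(e1, a), (e2, b), (e3, c)]"
  using assms by (auto simp: length_Suc_conv numeral_3_eq_3)

text \<open>Both sides run over the three-letter words with \<open>e\<close> letters
  \<open>v\<close>.\<close>

lemma Delta_two_coassoc:
  fixes x :: "(bool \<times> nat, 'r::comm_ring_1) tens"
  assumes dg: "\<And>x. odd (dg x) = fst x" and x: "x \<in> tpow 1"
  shows "insert_map dg 0 1 0 Delta_two (Delta_two x) = insert_map dg 1 1 0 Delta_two (Delta_two x)"
  using _ _ x
proof (rule linear_map_eq_on_tpow)
  fix w :: "(bool \<times> nat) list" assume "length w = 1"
  then obtain e j where w: "w = [(e, j)]" by (rule length_1E)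
  have L: "insert_map dg 0 1 0 Delta_two (gsum [b, b'] 0 j :: (bool \<times> nat, 'r) tens) =
      (\<Sum>us\<in>weight_words 2 b. gsum (us @ [b']) 0 j)" for b b'
    using insert_map_Delta_two[of dg 0 "[]" b "[b']" 0 j, OF dg] by simp
  have R: "insert_map dg 1 1 0 Delta_two (gsum [b, b'] 0 j :: (bool \<times> nat, 'r) tens) =
      (\<Sum>us\<in>weight_words 2 b'. gsum ([b] @ us) 0 j)" for b b'
    using insert_map_Delta_two[of dg 1 "[b]" b' "[]" 0 j, OF dg] by simp
  show "insert_map dg 0 1 0 Delta_two (Delta_two (basis w :: (bool \<times> nat, 'r) tens)) =
      insert_map dg 1 1 0 Delta_two (Delta_two (basis w))"
    unfolding w Delta_two_basis using L R
    by (cases e) (simp_all add: weight_words_2 module_hom.add[OF linear_map_insert_map] add_ac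
        del: weight_words.simps)
qed (rule linear_map_comp[OF linear_map_insert_map linear_map_Delta_two])+

section \<open>Associativity, counit, antipode and the Hopf algebra axioms\<close>

context exterior_divided_power
begin

lemma mu_assoc:
  assumes "x \<in> tpow 3"
  shows "\<mu> (insert_map dg 0 2 0 \<mu> x) = \<mu> (insert_map dg 1 2 0 \<mu> x)"
  using _ _ assms
proof (rule linear_map_eq_on_tpow)
  fix w :: "(bool \<times> nat) list" assume "length w = 3"
  then obtain e1 a e2 b e3 c where w: "w = [(e1, a), (e2, b), (e3, c)]" by (rule length_3E)
  have L: "insert_map dg 0 2 0 \<mu> (basis w) = tensor (\<mu> (basis [(e1, a), (e2, b)])) (basis [(e3, c)])"
    using insert_map_basis[of "[]" 0 "[(e1, a), (e2, b)]" 2 dg 0 \<mu> "[(e3, c)]"] by (simp add: w)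
  have R: "insert_map dg 1 2 0 \<mu> (basis w) = tensor (basis [(e1, a)]) (\<mu> (basis [(e2, b), (e3, c)]))"
    using insert_map_basis[of "[(e1, a)]" 1 "[(e2, b), (e3, c)]" 2 dg 0 \<mu> "[]"] by (simp add: w)
  \<comment> \<open>Both bracketings give the trinomial coefficient of \<open>a\<close>,
    \<open>b\<close>, \<open>c\<close>.\<close>
  have "(a + b choose a) * (a + b + c choose (a + b)) = (b + c choose b) * (a + (b + c) choose a)"
    using choose_mult_lemma[of b c a] by (simp add: ac_simps)
  then have "(of_nat (a + b choose a) * of_nat (a + b + c choose (a + b)) :: 'r) =
      of_nat (b + c choose b) * of_nat (a + (b + c) choose a)"
    by (metis of_nat_mult)
  then show "\<mu> (insert_map dg 0 2 0 \<mu> (basis w)) = \<mu> (insert_map dg 1 2 0 \<mu> (basis w))"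
    unfolding L R
    by (auto simp: mu_basis module_hom.scale[OF linear_mu] module_hom.zero[OF linear_mu] add.assoc)
qed (rule linear_map_comp[OF linear_mu linear_map_insert_map])+

lemma mu_in_Hom: "\<mu> \<in> Hom dg 0 2 1"
proof (rule HomI[OF linear_mu])
  fix w :: "(bool \<times> nat) list" assume "length w = 2"
  then obtain e a e' b where w: "w = [(e, a), (e', b)]" by (rule length_2E)
  show "\<mu> (basis w) \<in> tpow_deg dg 1 (wdeg dg w + 0)"
    by (auto simp: w mu_basis wdeg_def dg_eq algebra_simps intro!: tpow_deg_scale basis_in_tpow_deg)
qed

lemma counit_laws:
  fixes x :: "(bool \<times> nat, 'r) tens"
  assumes "x \<in> tpow 1"
  shows "tensor_map dg 1 counit 0 id (Delta_two x) = x" "tensor_map dg 1 id 0 counit (Delta_two x) = x"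
proof -
  have c: "counit (basis [(e, l)] :: (bool \<times> nat, 'r) tens) = (if e then 0 else if l = 0 then basis [] else 0)" for e l
    by (simp add: counit_def)
  have *: "(\<Sum>l\<le>j. tensor (if l = 0 then basis [] else 0) (basis [(e, j - l)])) = (basis [(e, j)] :: (bool \<times> nat, 'r) tens)"
    for e and j :: nat
    by (subst sum.mono_neutral_right[of _ "{0}"]) auto
  \<comment> \<open>The condition \<open>j \<le> l\<close> is the simplified form of
    \<open>j - l = 0\<close>, so only \<open>l = j\<close> survives.\<close>
  have **: "(\<Sum>l\<le>j. tensor (basis [(e, l)]) (if j \<le> l then basis [] else 0)) = (basis [(e, j)] :: (bool \<times> nat, 'r) tens)"
    for e and j :: nat
    by (subst sum.mono_neutral_right[of _ "{j}"]) auto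
  show "tensor_map dg 1 counit 0 id (Delta_two x) = x"
    using linear_map_comp[OF linear_map_tensor_map linear_map_Delta_two] linear_map_id(2) assms
  proof (rule linear_map_eq_on_tpow)
    fix w :: "(bool \<times> nat) list" assume "length w = 1"
    then obtain e j where w: "w = [(e, j)]" by (rule length_1E)
    show "tensor_map dg 1 counit 0 id (Delta_two (basis w)) = (basis w :: (bool \<times> nat, 'r) tens)"
      unfolding w Delta_two_basis
      by (cases e) (simp_all add: weight_words_2 gsum_pair module_hom.add[OF linear_map_tensor_map]
          module_hom.sum[OF linear_map_tensor_map] tensor_map_pair[unfolded One_nat_def] c * del: weight_words.simps)
  qed
  show "tensor_map dg 1 id 0 counit (Delta_two x) = x"
    using linear_map_comp[OF linear_map_tensor_map linear_map_Delta_two] linear_map_id(2) assms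
  proof (rule linear_map_eq_on_tpow)
    fix w :: "(bool \<times> nat) list" assume "length w = 1"
    then obtain e j where w: "w = [(e, j)]" by (rule length_1E)
    show "tensor_map dg 1 id 0 counit (Delta_two (basis w)) = (basis w :: (bool \<times> nat, 'r) tens)"
      unfolding w Delta_two_basis using **
      by (cases e) (simp_all add: weight_words_2 gsum_pair module_hom.add[OF linear_map_tensor_map]
          module_hom.sum[OF linear_map_tensor_map] tensor_map_pair[unfolded One_nat_def] c del: weight_words.simps)
  qed
qed

text \<open>On each word of exponents the law is an alternating sum of binomials. For
  \<open>v \<gamma>_j\<close> the two words contribute with opposite signs, since the antipode hits
  \<open>v\<close> in exactly one of them.\<close>

lemma antipode_laws:
  assumes "x \<in> tpow 1"
  shows "\<mu> (tensor_map dg 1 antipode 0 id (Delta_two x)) = unit_map (counit x)"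
    "\<mu> (tensor_map dg 1 id 0 antipode (Delta_two x)) = unit_map (counit x)"
proof -
  have a: "antipode (basis [(e, l)]) = scale ((if e then - 1 else 1) * (- 1) ^ l) (basis [(e, l)] :: (bool \<times> nat, 'r) tens)" for e l
    by (simp add: antipode_def)
  have uc: "unit_map (counit (basis [(e, j)] :: (bool \<times> nat, 'r) tens)) = (if e then 0 else scale (of_bool (j = 0)) (basis [(False, j)]))" for e j
    by (simp add: unit_map_def counit_def)
  note expand = gsum_pair module_hom.sum[OF linear_map_tensor_map] module_hom.sum[OF linear_mu]
    tensor_map_pair[unfolded One_nat_def] a module_hom.scale[OF linear_mu] mu_basis
    sum_distrib_left scale.scale_sum_left sum_negf
  have left: "\<mu> (tensor_map dg 1 antipode 0 id (gsum [e, e'] 0 j)) =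
      (if e \<and> e' then 0 else scale ((if e then - 1 else 1) * of_bool (j = 0)) (basis [(e \<or> e', j)]))" for e e' j
    unfolding sum_alternating_choose(1)[symmetric, of j] by (simp add: expand)
  have right: "\<mu> (tensor_map dg 1 id 0 antipode (gsum [e, e'] 0 j)) =
      (if e \<and> e' then 0 else scale ((if e' then - 1 else 1) * of_bool (j = 0)) (basis [(e \<or> e', j)]))" for e e' j
    unfolding sum_alternating_choose(2)[symmetric, of j] by (simp add: expand)
  note lin = linear_map_comp[OF linear_mu linear_map_comp[OF linear_map_tensor_map linear_map_Delta_two]]
     linear_map_comp[OF linear_map_structure(1,2)]
  show "\<mu> (tensor_map dg 1 antipode 0 id (Delta_two x)) = unit_map (counit x)"
    using lin assms
  proof (rule linear_map_eq_on_tpow)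
    fix w :: "(bool \<times> nat) list" assume "length w = 1"
    then obtain e j where w: "w = [(e, j)]" by (rule length_1E)
    show "\<mu> (tensor_map dg 1 antipode 0 id (Delta_two (basis w))) = unit_map (counit (basis w))"
      unfolding w Delta_two_basis uc
      by (cases e) (simp_all add: weight_words_2 module_hom.add[OF linear_map_tensor_map] module_hom.add[OF linear_mu]
          left[unfolded One_nat_def] del: weight_words.simps)
  qed
  show "\<mu> (tensor_map dg 1 id 0 antipode (Delta_two x)) = unit_map (counit x)"
    using lin assms
  proof (rule linear_map_eq_on_tpow)
    fix w :: "(bool \<times> nat) list" assume "length w = 1"
    then obtain e j where w: "w = [(e, j)]" by (rule length_1E)
    show "\<mu> (tensor_map dg 1 id 0 antipode (Delta_two (basis w))) = unit_map (counit (basis w))"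
      unfolding w Delta_two_basis uc
      by (cases e) (simp_all add: weight_words_2 module_hom.add[OF linear_map_tensor_map] module_hom.add[OF linear_mu]
          right[unfolded One_nat_def] del: weight_words.simps)
  qed
qed

lemma Hopf_algebra: "Hopf_algebra dg Delta_two \<mu>"
proof -
  let ?\<Delta> = "Delta_two :: (bool \<times> nat, 'r) tens \<Rightarrow> (bool \<times> nat, 'r) tens"
  let ?\<eta> = "unit_map :: (bool \<times> nat, 'r) tens \<Rightarrow> (bool \<times> nat, 'r) tens"
  let ?\<epsilon> = "counit :: (bool \<times> nat, 'r) tens \<Rightarrow> (bool \<times> nat, 'r) tens"
  let ?S = "antipode :: (bool \<times> nat, 'r) tens \<Rightarrow> (bool \<times> nat, 'r) tens"
  have alg: "algebra_map dg 2 \<mu> (mult_tpow dg 2 \<mu>) ?\<Delta>"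
    by (rule algebra_mapI[OF linear_map_Delta_two Delta_two_basis_coprod])
  have eta_Hom: "?\<eta> \<in> Hom dg 0 0 1"
    by (rule HomI) (auto simp: unit_map_def wdeg_def dg_eq intro!: basis_in_tpow_deg)
  have eps_Hom: "?\<epsilon> \<in> Hom dg 0 1 0"
    by (rule HomI) (auto simp: counit_def wdeg_def dg_eq intro!: basis_in_tpow_deg)
  have S_Hom: "?S \<in> Hom dg 0 1 1"
  proof (rule HomI)
    fix w :: "(bool \<times> nat) list" assume "length w = 1"
    then obtain e j where w: "w = [(e, j)]" by (rule length_1E)
    have "?S (basis w) = scale ((- 1) ^ (of_bool e + j)) (basis w)"
      by (simp add: w antipode_def)
    then show "?S (basis w) \<in> tpow_deg dg 1 (wdeg dg w + 0)"
      by (simp only:) (intro tpow_deg_scale basis_in_tpow_deg; simp add: w)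
  qed simp
  have unit_law: "\<mu> (tensor_map dg 0 ?\<eta> 0 id x) = x \<and> \<mu> (tensor_map dg 1 id 0 ?\<eta> x) = x" if x: "x \<in> tpow 1" for x
  proof
    show "\<mu> (tensor_map dg 0 ?\<eta> 0 id x) = x"
      using linear_map_comp[OF linear_mu linear_map_tensor_map] linear_map_id(2) x
    proof (rule linear_map_eq_on_tpow)
      fix w :: "(bool \<times> nat) list" assume "length w = 1"
      then obtain e j where w: "w = [(e, j)]" by (rule length_1E)
      show "\<mu> (tensor_map dg 0 ?\<eta> 0 id (basis w)) = basis w"
        using tensor_map_basis[of "[]" 0 dg ?\<eta> 0 id w] by (simp add: w unit_map_def mu_basis)
    qed
    show "\<mu> (tensor_map dg 1 id 0 ?\<eta> x) = x"
      using linear_map_comp[OF linear_mu linear_map_tensor_map] linear_map_id(2) x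
    proof (rule linear_map_eq_on_tpow)
      fix w :: "(bool \<times> nat) list" assume "length w = 1"
      then obtain e j where w: "w = [(e, j)]" by (rule length_1E)
      show "\<mu> (tensor_map dg 1 id 0 ?\<eta> (basis w)) = basis w"
        using tensor_map_basis[of w 1 dg id 0 ?\<eta> "[]"] by (simp add: w unit_map_def mu_basis)
    qed
  qed
  have Delta_unit: "?\<Delta> (?\<eta> x) = tensor_map dg 0 ?\<eta> 0 ?\<eta> x" if x: "x \<in> tpow 0" for x
    using linear_map_comp[OF linear_map_Delta_two linear_map_structure(1)] linear_map_tensor_map x
  proof (rule linear_map_eq_on_tpow)
    fix w :: "(bool \<times> nat) list" assume "length w = 0"
    then show "?\<Delta> (?\<eta> (basis w)) = tensor_map dg 0 ?\<eta> 0 ?\<eta> (basis w)"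
      using tensor_map_basis[of "[]" 0 dg ?\<eta> 0 ?\<eta> "[]"]
      by (simp add: unit_map_def Delta_two_basis weight_words_2 gsum_pair del: weight_words.simps)
  qed
  have counit_mult: "?\<epsilon> (\<mu> x) = tensor_map dg 1 ?\<epsilon> 0 ?\<epsilon> x" if x: "x \<in> tpow 2" for x
    using linear_map_comp[OF linear_map_structure(2) linear_mu] linear_map_tensor_map x
  proof (rule linear_map_eq_on_tpow)
    fix w :: "(bool \<times> nat) list" assume "length w = 2"
    then obtain e a e' b where w: "w = [(e, a), (e', b)]" by (rule length_2E)
    show "?\<epsilon> (\<mu> (basis w)) = tensor_map dg 1 ?\<epsilon> 0 ?\<epsilon> (basis w)"
      unfolding w tensor_map_pair
      by (auto simp: mu_basis counit_def module_hom.scale[OF linear_map_lin])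
  qed
  have counit_unit: "?\<epsilon> (?\<eta> x) = x" if x: "x \<in> tpow 0" for x
    using linear_map_comp[OF linear_map_structure(2,1)] linear_map_id(2) x
    by (rule linear_map_eq_on_tpow) (simp add: unit_map_def counit_def)
  show ?thesis
    unfolding Hopf_algebra_def
  proof (intro conjI)
    show "\<exists>\<eta> \<epsilon> S. \<eta> \<in> Hom dg 0 0 1 \<and> \<epsilon> \<in> Hom dg 0 1 0 \<and> S \<in> Hom dg 0 1 1 \<and>
        (\<forall>x\<in>tpow 1. \<mu> (tensor_map dg 0 \<eta> 0 id x) = x \<and> \<mu> (tensor_map dg 1 id 0 \<eta> x) = x) \<and>
        (\<forall>x\<in>tpow 1. tensor_map dg 1 \<epsilon> 0 id (?\<Delta> x) = x \<and> tensor_map dg 1 id 0 \<epsilon> (?\<Delta> x) = x) \<and>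
        (\<forall>x\<in>tpow 0. ?\<Delta> (\<eta> x) = tensor_map dg 0 \<eta> 0 \<eta> x) \<and>
        (\<forall>x\<in>tpow 2. \<epsilon> (\<mu> x) = tensor_map dg 1 \<epsilon> 0 \<epsilon> x) \<and>
        (\<forall>x\<in>tpow 0. \<epsilon> (\<eta> x) = x) \<and>
        (\<forall>x\<in>tpow 1. \<mu> (tensor_map dg 1 S 0 id (?\<Delta> x)) = \<eta> (\<epsilon> x) \<and>
                    \<mu> (tensor_map dg 1 id 0 S (?\<Delta> x)) = \<eta> (\<epsilon> x))"
      using eta_Hom eps_Hom S_Hom unit_law counit_laws Delta_unit counit_mult counit_unit antipode_laws
      by (intro exI[of _ ?\<eta>] exI[of _ ?\<epsilon>] exI[of _ ?S]) blast
  qed (use alg mu_in_Hom mu_assoc Delta_two_coassoc[OF odd_dg] in \<open>auto simp: algebra_map_def\<close>)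
qed

end

section \<open>The \<open>A\<^sub>\<infinity>\<close>-relations\<close>

lemma sum_telescope_alternating:
  "(\<Sum>i<n. scale ((- 1) ^ i) (P (Suc i) + P i)) = P 0 - scale ((- 1) ^ n) (P n :: 'a \<Rightarrow>\<^sub>0 'r::comm_ring_1)"
  by (induction n) (simp_all add: scale.scale_right_distrib)

context exterior_divided_power
begin

text \<open>The half of the relation for \<open>m = p + 1\<close> in which the coproduct is applied
  last; it telescopes to the two boundary words.\<close>

lemma insert_Delta_two_Delta_p:
  assumes "p > 0" "odd p"
  shows "(\<Sum>i\<in>{0..p - 1}. scale ((- 1) ^ (p + 1 + i + 1))
      (insert_map dg i 1 0 Delta_two (Delta_p p (basis [(e, j)])))) =
    (if e then 0 else - (gsum (False # replicate p True) 1 j + gsum (replicate p True @ [False]) 1 j)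
      :: (bool \<times> nat, 'r) tens)"
proof (cases e)
  case True
  then show ?thesis
    by (simp add: Delta_p_basis assms module_hom.zero[OF linear_map_insert_map])
next
  case False
  \<comment> \<open>Of the \<open>p + 1\<close> positions, \<open>i\<close> is the one without
    \<open>v\<close>. Splitting the \<open>v\<close> in position \<open>i\<close> of the word of
    \<open>p\<close> letters puts the 1 in position \<open>i + 1\<close> or
    \<open>i\<close>.\<close>
  let ?P = "\<lambda>i. gsum (replicate i True @ False # replicate (p - i) True) 1 j :: (bool \<times> nat, 'r) tens"
  have ins: "insert_map dg i 1 0 Delta_two (gsum (replicate p True) 1 j) = ?P (Suc i) + ?P i" if "i < p" for i
  proof -
    have p: "replicate p True = replicate i True @ True # replicate (p - Suc i) True"
      "replicate (p - i) True = True # replicate (p - Suc i) True"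
      using that by (simp_all add: replicate_add[symmetric] flip: replicate_Suc)
    have "insert_map dg i 1 0 Delta_two (gsum (replicate i True @ True # replicate (p - Suc i) True) 1 j) =
        (\<Sum>us\<in>weight_words 2 True. gsum (replicate i True @ us @ replicate (p - Suc i) True) 1 j :: (bool \<times> nat, 'r) tens)"
      by (rule insert_map_Delta_two[OF odd_dg]) simp
    then show ?thesis
      unfolding p by (simp add: weight_words_2 replicate_app_Cons_same del: weight_words.simps)
  qed
  have "(\<Sum>i\<in>{0..p - 1}. scale ((- 1) ^ (p + 1 + i + 1))
      (insert_map dg i 1 0 Delta_two (Delta_p p (basis [(e, j)])))) =
      (\<Sum>i<p. - scale ((- 1) ^ i) (?P (Suc i) + ?P i))"
    using assms False ins
    by (intro sum.cong) (auto simp: Delta_p_basis power_add)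
  also have "\<dots> = - (?P 0 - scale ((- 1) ^ p) (?P p))"
    by (simp only: sum_negf sum_telescope_alternating[where P = ?P])
  also have "\<dots> = - (gsum (False # replicate p True) 1 j + gsum (replicate p True @ [False]) 1 j)"
    using assms by simp
  finally show ?thesis using False by simp
qed

text \<open>On \<open>\<gamma>_j\<close> the boundary words appear with plus signs. On
  \<open>v \<gamma>_j\<close> the all-\<open>v\<close> word appears twice, once negated because an
  operation of odd degree passes \<open>v\<close>.\<close>

lemma insert_Delta_p_Delta_two:
  assumes "p > 0" "odd k"
  shows "insert_map dg 0 1 k (Delta_p p) (Delta_two (basis [(e, j)])) +
      insert_map dg 1 1 k (Delta_p p) (Delta_two (basis [(e, j)])) =
    (if e then 0 else gsum (False # replicate p True) 1 j + gsum (replicate p True @ [False]) 1 j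
      :: (bool \<times> nat, 'r) tens)"
proof -
  have L: "insert_map dg 0 1 k (Delta_p p) (gsum [b, b'] 0 j) =
     (if b then 0 else gsum (replicate p True @ [b']) 1 j :: (bool \<times> nat, 'r) tens)" for b b'
    using insert_map_Delta_p[of dg 0 "[]" p k b "[b']" 0 j, OF odd_dg] assms by (cases b) simp_all
  have R: "insert_map dg 1 1 k (Delta_p p) (gsum [b, b'] 0 j) =
     (if b' then 0 else scale (if b then - 1 else 1) (gsum (b # replicate p True) 1 j) :: (bool \<times> nat, 'r) tens)" for b b'
    using insert_map_Delta_p[of dg 1 "[b]" p k b' "[]" 0 j, OF odd_dg] assms
    by (cases b; cases b') (simp_all add: ksign_def)
  have "True # replicate p True = replicate p True @ [True]"
    by (simp add: replicate_append_same)
  then show ?thesis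
    unfolding Delta_two_basis using L R
    by (cases e) (simp_all add: weight_words_2 module_hom.add[OF linear_map_insert_map] del: weight_words.simps)
qed

text \<open>All factors produced by the inner operation contain \<open>v\<close>, and the outer one
  vanishes on these.\<close>

lemma insert_Delta_p_Delta_p:
  assumes "p > 0" "i < p"
  shows "insert_map dg i 1 k (Delta_p p) (Delta_p p (basis [(e, j)])) = (0 :: (bool \<times> nat, 'r) tens)"
proof -
  have p: "replicate p True = replicate i True @ True # replicate (p - Suc i) True"
    using assms by (simp add: replicate_add[symmetric] flip: replicate_Suc)
  have "insert_map dg i 1 k (Delta_p p) (gsum (replicate p True) 1 j) = (0 :: (bool \<times> nat, 'r) tens)"
    by (subst p, subst insert_map_Delta_p[OF odd_dg]) (simp_all add: assms)
  then show ?thesis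
    using assms by (simp add: Delta_p_basis module_hom.zero[OF linear_map_insert_map])
qed

text \<open>A term survives only if \<open>q + 1\<close> and \<open>m - q\<close> both lie in
  \<open>{2, p}\<close>, so \<open>m\<close> is 3, \<open>p + 1\<close> or \<open>2p - 1\<close>:
  coassociativity, the mixed relation and the square of the higher operation.\<close>

lemma Ainf_relation_basis:
  fixes e :: bool and j :: nat
  assumes p: "p \<ge> 3" "odd p" and m: "m \<ge> 1"
  defines "\<psi> \<equiv> \<lambda>k. if k = 2 then Delta_two else if k = p then Delta_p p else (\<lambda>_. 0)"
  shows "(\<Sum>q\<in>{0..m - 1}. \<Sum>i\<in>{0..m - q - 1}. scale ((- 1) ^ (q * (m + i + 1)))
     (insert_map dg i 1 (int (q + 1) - 2) (\<psi> (q + 1)) (\<psi> (m - q) (basis [(e, j)])))) =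
     (0 :: (bool \<times> nat, 'r) tens)"
proof -
  let ?t = "\<lambda>q. \<Sum>i\<in>{0..m - q - 1}. scale ((- 1) ^ (q * (m + i + 1)))
     (insert_map dg i 1 (int (q + 1) - 2) (\<psi> (q + 1)) (\<psi> (m - q) (basis [(e, j)]))) :: (bool \<times> nat, 'r) tens"
  have zero: "?t q = 0" if "q + 1 \<notin> {2, p} \<or> m - q \<notin> {2, p}" for q
    using that by (auto simp: \<psi>_def module_hom.zero[OF linear_map_insert_map] intro!: sum.neutral)
  have psi: "\<psi> 2 = Delta_two" "\<psi> p = Delta_p p" using p by (auto simp: \<psi>_def)
  show ?thesis
  proof (cases "m = p + 1")
    case True
    have "?t 1 = (if e then 0 else - (gsum (False # replicate p True) 1 j + gsum (replicate p True @ [False]) 1 j))"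
      using insert_Delta_two_Delta_p[of p e j] p psi True by (simp add: numeral_2_eq_2)
    moreover have "?t (p - 1) = (if e then 0 else gsum (False # replicate p True) 1 j + gsum (replicate p True @ [False]) 1 j)"
    proof -
      have arith: "m - (p - 1) = 2" "p - 1 + 1 = p" "{0..2 - 1} = {0, 1::nat}"
        using True p by auto
      \<comment> \<open>As \<open>p - 1\<close> is even, both insertions carry a plus sign, opposite
        to the telescoped terms.\<close>
      have sign: "((- 1) ^ ((p - 1) * r) :: 'r) = 1" for r
        using p by (simp add: power_mult)
      have "?t (p - 1) = (\<Sum>i\<in>{0, 1}. insert_map dg i 1 (int p - 2) (Delta_p p) (Delta_two (basis [(e, j)])))"
        by (simp only: arith sign psi scale.scale_one)
      then show ?thesis
        using insert_Delta_p_Delta_two[of p "int p - 2" e j] p by simp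
    qed
    moreover have "(\<Sum>q\<in>{0..m - 1}. ?t q) = (\<Sum>q\<in>{1, p - 1}. ?t q)"
    proof (rule sum.mono_neutral_right)
      show "\<forall>q\<in>{0..m - 1} - {1, p - 1}. ?t q = 0"
      proof
        fix q assume "q \<in> {0..m - 1} - {1, p - 1}"
        then have "q + 1 \<notin> {2, p}" by auto
        then show "?t q = 0" by (intro zero) blast
      qed
    qed (use True p in auto)
    ultimately show ?thesis using p by auto
  next
    case False
    show ?thesis
    proof (rule sum.neutral, rule ballI)
      fix q assume q: "q \<in> {0..m - 1}"
      consider "q + 1 = 2" "m - q = 2" | "q + 1 = p" "m - q = p" | "q + 1 \<notin> {2, p} \<or> m - q \<notin> {2, p}"
        using False q p m by force
      then show "?t q = 0"
      proof cases
        case 1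
        have "basis [(e, j)] \<in> (tpow 1 :: (bool \<times> nat, 'r) tens set)"
          using tpow_degD[OF basis_in_tpow_deg[OF _ refl, of "[(e, j)]" 1]] by simp
        from Delta_two_coassoc[OF odd_dg this] 1 show ?thesis
          using psi(1) by (simp add: numeral_2_eq_2 numeral_3_eq_3)
      next
        case 2
        then have "i < p" if "i \<in> {0..m - q - 1}" for i using that p by auto
        then show ?thesis
          using 2 psi p insert_Delta_p_Delta_p[of p] by (intro sum.neutral) auto
      qed (rule zero)
    qed
  qed
qed

text \<open>The condition on \<open>d1\<close> and \<open>d2\<close> says that the operation has the
  degree \<open>p - 2\<close> required of \<open>\<psi>^p\<close>.\<close>

lemma Hopf_Ainf_coalgebra:
  assumes p: "p \<ge> 3" "odd p" and d: "int p * d1 - d2 = int p - 2"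
  shows "Hopf_Ainf_coalgebra dg p Delta_two (Delta_p p) \<mu>"
proof -
  let ?\<psi> = "\<lambda>k. if k = 2 then Delta_two else if k = p then Delta_p p else (\<lambda>_. 0) ::
    (bool \<times> nat, 'r) tens \<Rightarrow> (bool \<times> nat, 'r) tens"
  have iter: "iter_coprod dg Delta_two (p - 1) (basis [(e, j)]) = (coprod p e j :: (bool \<times> nat, 'r) tens)" for e j
    using iter_coprod_basis[OF odd_dg, of "p - 1"] p by simp
  have p0: "p > 0" using p by simp
  note der = is_derivation_Delta_p[OF p0 d linear_map_iter_coprod iter]
  have "(Delta_two :: (bool \<times> nat, 'r) tens \<Rightarrow> (bool \<times> nat, 'r) tens) \<in> Hom dg 0 1 2"
    using Hopf_algebra by (simp add: Hopf_algebra_def)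
  then have Hom: "?\<psi> k \<in> Hom dg (int k - 2) 1 k" for k
    using der(1) by (auto intro!: HomI)
  have lin: "linear_map (?\<psi> k)" for k
    by simp
  have "(\<Sum>q\<in>{0..m - 1}. \<Sum>i\<in>{0..m - q - 1}. scale ((- 1) ^ (q * (m + i + 1)))
     (insert_map dg i 1 (int (q + 1) - 2) (?\<psi> (q + 1)) (?\<psi> (m - q) x))) = 0"
    if m: "m \<ge> 1" and x: "x \<in> tpow 1" for m x
    using _ linear_map_zero x
  proof (rule linear_map_eq_on_tpow)
    show "linear_map (\<lambda>x. \<Sum>q\<in>{0..m - 1}. \<Sum>i\<in>{0..m - q - 1}. scale ((- 1) ^ (q * (m + i + 1)))
     (insert_map dg i 1 (int (q + 1) - 2) (?\<psi> (q + 1)) (?\<psi> (m - q) x)))"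
      by (intro linear_map_sum linear_map_scale linear_map_comp[OF linear_map_insert_map lin])
    fix w :: "(bool \<times> nat) list" assume "length w = 1"
    then obtain e j where w: "w = [(e, j)]" by (rule length_1E)
    show "(\<Sum>q\<in>{0..m - 1}. \<Sum>i\<in>{0..m - q - 1}. scale ((- 1) ^ (q * (m + i + 1)))
     (insert_map dg i 1 (int (q + 1) - 2) (?\<psi> (q + 1)) (?\<psi> (m - q) (basis w)))) = 0"
      unfolding w by (rule Ainf_relation_basis[OF p m])
  qed
  then have "Ainf_coalgebra dg ?\<psi>"
    using Hom by (simp only: Ainf_coalgebra_def) blast
  then show ?thesis
    using der Hopf_algebra p by (simp add: Hopf_Ainf_coalgebra_def)
qed

end

section \<open>The algebras \<open>A_i\<close> as an instance\<close>

theorem theorem4: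
  fixes p n i :: nat
  assumes "prime p" and "odd p" and "p = CARD('p::prime_card)" and "n \<ge> 1"
  shows "Hopf_Ainf_coalgebra (A_deg p n i) p
           (Delta_two :: (bool \<times> nat, 'p mod_ring) tens \<Rightarrow> (bool \<times> nat, 'p mod_ring) tens)
           (Delta_p p) (A_mult p n i)"
proof -
  let ?d1 = "int (2 * n * p ^ i + 1)" and ?d2 = "int (2 * n * p ^ (i + 1) + 2)"
  have "p \<noteq> 2" "p \<ge> 2"
    using assms(1,2) prime_ge_2_nat by auto
  then have p: "p \<ge> 3" by simp
  interpret exterior_divided_power ?d1 ?d2 "A_deg p n i"
    "A_mult p n i :: (bool \<times> nat, 'p mod_ring) tens \<Rightarrow> (bool \<times> nat, 'p mod_ring) tens"
  proof (rule exterior_divided_power.intro)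
    show "A_deg p n i (e, j) = of_bool e * ?d1 + int j * ?d2" for e j
      by (simp add: A_deg_def prod_deg_def E_deg_def Gamma_deg_def)
    show "linear_map (A_mult p n i :: (bool \<times> nat, 'p mod_ring) tens \<Rightarrow> _)"
      by (simp add: A_mult_def prod_mult_def)
    fix e a e' b
    \<comment> \<open>This exponent belongs to the interchange of the middle factors, which
      therefore introduces no sign.\<close>
    have "even (Gamma_deg ?d2 a * E_deg ?d1 e')"
      by (simp add: Gamma_deg_def)
    then show "A_mult p n i (basis [(e, a), (e', b)]) = (if e \<and> e' then 0
        else scale (of_nat (a + b choose a)) (basis [(e \<or> e', a + b)] :: (bool \<times> nat, 'p mod_ring) tens))"
      by (simp add: A_mult_def prod_mult_def E_mult_def Gamma_mult_def tensor2_def module_hom.scale[OF linear_map_lin])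
  qed simp_all
  show ?thesis
    \<comment> \<open>The degree of \<open>w_i\<close> is chosen so that
      \<open>p * (2np^i + 1) - (2np^(i+1) + 2) = p - 2\<close>.\<close>
    by (rule Hopf_Ainf_coalgebra[OF p assms(2)]) (simp add: algebra_simps)
qed

end
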